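(* Consider online interval selection on $[0,1]$ with target $\phi\in(0,1)$ and bandit feedback. For every horizon $T\ge2$ there is a policy (depending on $T$ and $\phi$ but not on the point sequence or its distribution) which chooses its intervals from the finite set of $n=O(1/\delta^2)$ intervals consisting of the empty interval and the intervals in $[0,1]$ whose endpoints are multiples of $\delta=T^{-1/4}$ (or equal to $1$), and satisfies both of the following. (i) Pathwise validity: for every sequence $y_1,\dots,y_T\in[0,1]$ and all integers $\ell$, $L\ge1$ with $[\ell,\ell+L-1]\subseteq[n-1,T]$, writing $Y_t=\mathbf 1\{y_t\in I_t\}$, $\Lambda=\frac{1}{1-\phi}$ and $\eta=1/\sqrt T$, $$\left|\frac1L\sum_{t=\ell}^{\ell+L-1}Y_t-\phi\right|\le\frac{\Lambda+2\eta}{\eta L}.$$ (ii) Stochastic efficiency: if the points $y_t$ are drawn i.i.d. from an unknown distribution $\mathcal D$ on $[0,1]$, then $$\mathbb E\left[\sum_{t=1}^T\left(|I_t|-C^*\right)\right]=\widetilde O\!\left(T^{3/4}\right),$$ where the $\widetilde O$ hides factors polylogarithmic in $T$ and constants depending only on $\phi$.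
   Context: Online interval selection with bandit feedback. At each step $t=1,\dots,T$ the policy outputs an interval $I_t\subseteq[0,1]$ (the empty interval and the whole of $[0,1]$ are allowed) before the point $y_t\in[0,1]$ is realized, and then observes only the bit $Y_t=\mathbf 1\{y_t\in I_t\}$, not $y_t$ itself. $I_t$ may depend only on past observations (and internal randomness). The cost of $I_t$ is its length $|I_t|$ (with $|\emptyset|=0$, and $|[0,1]|=1=C_{\max}$). Benchmark. $C^*$ is the optimal expected per-step cost of a stochastic policy satisfying validity in expectation: $C^*=\inf_\nu\mathbb E_{I\sim\nu}[|I|]$ over all probability distributions $\nu$ on intervals $I\subseteq[0,1]$ (including the empty one) such that $\Pr_{I\sim\nu,\,y\sim\mathcal D}[y\in I]\ge\phi$, with $I$ and $y$ independent. *)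

theory Defs
  imports "HOL-Probability.Probability" "HOL-Library.Landau_Symbols"
begin

(* Intervals are sets of reals, of any kind (open, closed, half-open, degenerate, empty); the
   length of I is measure lborel I.  The set of intervals has no canonical sigma-algebra, so a
   random interval carries the two measurability conditions that make its expected length and its
   probability of containing an independent random point meaningful. *)

definition random_interval :: "'w measure \<Rightarrow> ('w \<Rightarrow> real set) \<Rightarrow> bool" where
  "random_interval M I \<longleftrightarrow>
     prob_space M \<and>
     (\<forall>w\<in>space M. is_interval (I w) \<and> I w \<subseteq> {0..1}) \<and>
     (\<lambda>w. measure lborel (I w)) \<in> borel_measurable M \<and>
     Measurable.pred (M \<Otimes>\<^sub>M borel) (\<lambda>z. snd z \<in> I (fst z))"

definition unit_distribution :: "real measure \<Rightarrow> bool" where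
  "unit_distribution D \<longleftrightarrow> prob_space D \<and> sets D = sets borel \<and> measure D {0..1} = 1"

(* nu ranges over all probability distributions on the set of intervals. *)
definition optimal_cost :: "real measure \<Rightarrow> real \<Rightarrow> real" where
  "optimal_cost D \<phi> =
     Inf {(\<integral>I. measure lborel I \<partial>\<nu>) | \<nu> :: real set measure.
            random_interval \<nu> (\<lambda>I. I) \<and>
            measure (\<nu> \<Otimes>\<^sub>M D) {z \<in> space (\<nu> \<Otimes>\<^sub>M D). snd z \<in> fst z} \<ge> \<phi>}"

(* A randomized policy: \<pi> u h is the interval output on internal randomness u (drawn once, with
   law R) after the bits h have been observed.  The policy's own past intervals are determined by
   u and h, so they need not be recorded in h.  Histories being finitely many at each step, the
   measurability in random_interval makes all costs and observations of a run measurable. *)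
definition bandit_policy :: "real measure \<Rightarrow> (real \<Rightarrow> bool list \<Rightarrow> real set) \<Rightarrow> bool" where
  "bandit_policy R \<pi> \<longleftrightarrow> (\<forall>h. random_interval R (\<lambda>u. \<pi> u h))"

(* feedback p y t lists the bits Y_1, ..., Y_t when the rule p meets the points y 1, y 2, ... *)
primrec feedback :: "(bool list \<Rightarrow> real set) \<Rightarrow> (nat \<Rightarrow> real) \<Rightarrow> nat \<Rightarrow> bool list" where
  "feedback p y 0 = []"
| "feedback p y (Suc t) = feedback p y t @ [y (Suc t) \<in> p (feedback p y t)]"

(* Steps are numbered from 1. *)
definition chosen :: "(bool list \<Rightarrow> real set) \<Rightarrow> (nat \<Rightarrow> real) \<Rightarrow> nat \<Rightarrow> real set" where
  "chosen p y t = p (feedback p y (t - 1))"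

definition covered :: "(bool list \<Rightarrow> real set) \<Rightarrow> (nat \<Rightarrow> real) \<Rightarrow> nat \<Rightarrow> real" where
  "covered p y t = of_bool (y t \<in> chosen p y t)"

definition mesh :: "nat \<Rightarrow> real" where
  "mesh T = real T powr (- 1 / 4)"

definition grid_points :: "nat \<Rightarrow> real set" where
  "grid_points T = {x \<in> {0..1}. x = 1 \<or> (\<exists>k::nat. x = real k * mesh T)}"

(* Closed intervals; the degenerate ones {a..a} are included. *)
definition grid_intervals :: "nat \<Rightarrow> real set set" where
  "grid_intervals T =
     insert {} {{a..b} | a b. a \<in> grid_points T \<and> b \<in> grid_points T \<and> a \<le> b}"

end

(* The policy is deterministic. It runs dual ascent with step eta = 1 / sqrt T on a multiplier
   lam, starting from 0. It plays the empty interval while lam < 0 and [0,1] while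
   lam > Lambda = 1 / (1 - phi), so that lam stays in [-eta, Lambda + eta] on every point sequence;
   since eta times a sum of Y_t - phi over a window is a difference of two values of lam, this is
   pathwise validity. While lam lies in [0, Lambda], it first probes each of the O(1 / delta)
   intervals [0,x] and [x,1] with x a grid point ceil (sqrt T) times, and from then on minimizes
   |I| - lam * q(I) over the grid, where q([a,b]) = q([0,b]) + q([a,1]) - 1 is read off the empirical
   frequencies. Only O(T^(1/4)) numbers, not n, are estimated, so that probing costs O(T^(3/4)) and
   the estimates are accurate to T^(-1/4) up to a logarithm.

   For the cost, weak Lagrangian duality gives |I_t| - C* <= lam_t (P(I_t) - phi) up to the estimation
   and rounding errors; the choice of Lambda is what makes this hold for the forced interval [0,1].
   The expectations of lam_t (P(I_t) - phi) sum to at most eta T / 2 by the drift of lam^2 / (2 eta).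
   Conversely, the time average of the laws of the I_t has coverage phi - O(1 / sqrt T), and mixing
   it with a small weight on [0,1] makes it admissible for C*. *)

theory Submission
  imports Defs
begin

section \<open>Grid intervals\<close>

lemma mesh_pos: "T \<ge> 1 \<Longrightarrow> 0 < mesh T"
  by (simp add: mesh_def)

lemma mesh_le_one: "T \<ge> 1 \<Longrightarrow> mesh T \<le> 1"
  using powr_mono[of "-1/4" 0 "real T"] by (simp add: mesh_def)

lemma zero_one_grid: "0 \<in> grid_points T" "1 \<in> grid_points T"
  by (auto simp: grid_points_def intro: exI[of _ 0])

lemma grid_points_unit: "grid_points T \<subseteq> {0..1}"
  by (auto simp: grid_points_def)

lemma
  assumes "T \<ge> 1"
  shows finite_grid_points: "finite (grid_points T)"
    and card_grid_points: "real (card (grid_points T)) \<le> 2 + 1 / mesh T"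
proof -
  let ?K = "nat \<lfloor>1 / mesh T\<rfloor>"
  have sub: "grid_points T \<subseteq> insert 1 ((\<lambda>k. real k * mesh T) ` {..?K})"
  proof
    fix x assume x: "x \<in> grid_points T"
    show "x \<in> insert 1 ((\<lambda>k. real k * mesh T) ` {..?K})"
    proof (cases "x = 1")
      case False
      then obtain k where k: "x = real k * mesh T" "x \<le> 1"
        using x by (auto simp: grid_points_def)
      then have "real k \<le> 1 / mesh T"
        using mesh_pos[OF assms] by (simp add: field_simps)
      then have "k \<le> ?K" by (simp add: le_nat_floor)
      then show ?thesis using k by blast
    qed simp
  qed
  show "finite (grid_points T)" by (rule finite_subset[OF sub]) simp
  have "card (grid_points T) \<le> card (insert 1 ((\<lambda>k. real k * mesh T) ` {..?K}))"
    by (rule card_mono[OF _ sub]) simp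
  also have "\<dots> \<le> Suc (card ((\<lambda>k. real k * mesh T) ` {..?K}))"
    by (rule card_insert_le_m1) simp_all
  also have "\<dots> \<le> Suc (Suc ?K)"
    using card_image_le[of "{..?K}" "\<lambda>k. real k * mesh T"] by simp
  finally have "real (card (grid_points T)) \<le> real (Suc (Suc ?K))"
    by (rule of_nat_mono)
  also have "\<dots> \<le> 2 + 1 / mesh T"
    using mesh_pos[OF assms] by simp
  finally show "real (card (grid_points T)) \<le> 2 + 1 / mesh T" .
qed

lemma
  assumes "T \<ge> 1"
  shows finite_grid_intervals: "finite (grid_intervals T)"
    and card_grid_intervals: "real (card (grid_intervals T)) \<le> 10 / (mesh T)\<^sup>2"
proof -
  let ?P = "(\<lambda>(a, b). {a..b}) ` (grid_points T \<times> grid_points T)"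
  have sub: "grid_intervals T \<subseteq> insert {} ?P"
    by (auto simp: grid_intervals_def)
  have fin: "finite ?P"
    using finite_grid_points[OF assms] by simp
  show "finite (grid_intervals T)" by (rule finite_subset[OF sub]) (simp add: fin)
  have "card (grid_intervals T) \<le> card (insert {} ?P)"
    by (rule card_mono[OF _ sub]) (simp add: fin)
  also have "\<dots> \<le> Suc (card ?P)"
    by (rule card_insert_le_m1) simp_all
  also have "card ?P \<le> card (grid_points T) * card (grid_points T)"
    using card_image_le[of "grid_points T \<times> grid_points T" "\<lambda>(a, b). {a..b}"]
      finite_grid_points[OF assms] by (simp add: card_cartesian_product)
  finally have "real (card (grid_intervals T)) \<le> 1 + (real (card (grid_points T)))\<^sup>2"
    by (simp add: power2_eq_square flip: of_nat_mult of_nat_Suc)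
  \<comment> \<open>Since 1 / \<open>mesh T\<close> is at least 1, it absorbs the additive
    constants: 1 from the empty interval and 9 from the pairs of endpoints give 10.\<close>
  also have "\<dots> \<le> (1 / mesh T)\<^sup>2 + (3 * (1 / mesh T))\<^sup>2"
  proof (intro add_mono power_mono)
    have ge1: "1 \<le> 1 / mesh T"
      using mesh_pos[OF assms] mesh_le_one[OF assms] by simp
    then show "1 \<le> (1 / mesh T)\<^sup>2" by (rule one_le_power)
    show "real (card (grid_points T)) \<le> 3 * (1 / mesh T)"
      using card_grid_points[OF assms] ge1 by linarith
  qed simp
  also have "\<dots> = 10 / (mesh T)\<^sup>2"
    by (simp add: power_divide power_mult_distrib)
  finally show "real (card (grid_intervals T)) \<le> 10 / (mesh T)\<^sup>2" .
qed

lemma grid_intervals_cases: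
  assumes "I \<in> grid_intervals T"
  obtains "I = {}"
  | a b where "a \<in> grid_points T" "b \<in> grid_points T" "a \<le> b" "I = {a..b}"
  using assms by (auto simp: grid_intervals_def)

lemma empty_in_grid: "{} \<in> grid_intervals T"
  by (simp add: grid_intervals_def)

lemma Icc_in_grid:
  "a \<in> grid_points T \<Longrightarrow> b \<in> grid_points T \<Longrightarrow> a \<le> b \<Longrightarrow> {a..b} \<in> grid_intervals T"
  by (auto simp: grid_intervals_def)

lemma
  assumes "I \<in> grid_intervals T"
  shows grid_interval_borel: "I \<in> sets borel"
    and grid_interval_is_interval: "is_interval I"
    and grid_interval_unit: "I \<subseteq> {0..1}"
proof -
  show "I \<in> sets borel" "is_interval I"
    using assms by (auto elim: grid_intervals_cases simp: is_interval_cc)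
  show "I \<subseteq> {0..1}"
    using assms by (rule grid_intervals_cases) (use grid_points_unit[of T] in force)+
qed

section \<open>Measurability, length and rounding of intervals in [0,1]\<close>

lemma is_interval_borel: "is_interval (J :: real set) \<Longrightarrow> J \<in> sets borel"
  by (simp add: borel_measurable_vimage real_interval_borel_measurable)

lemma fmeasurable_unit:
  fixes J :: "real set"
  assumes "J \<in> sets borel" "J \<subseteq> {0..1}"
  shows "J \<in> fmeasurable lborel"
  by (rule fmeasurableI2[of "{0..1}"]) (use assms in \<open>simp_all add: fmeasurable_def\<close>)

lemma measure_lborel_unit_le_one:
  fixes J :: "real set"
  assumes "J \<subseteq> {0..1}"
  shows "measure lborel J \<le> 1"
proof (cases "J \<in> sets borel")
  case True
  have "measure lborel J \<le> measure lborel {0..1::real}"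
    by (rule measure_mono_fmeasurable[OF assms]) (use True in \<open>simp_all add: fmeasurable_unit\<close>)
  then show ?thesis by simp
qed (simp add: measure_notin_sets)

text \<open>The left endpoint is rounded down and the right one up, each moving by at most one mesh.
  Rounding outward keeps all the coverage of J; only its length suffers.\<close>

lemma grid_outer_approximation:
  assumes "T \<ge> 1" "is_interval J" "J \<subseteq> {0..1}"
  shows "\<exists>I\<in>grid_intervals T. J \<subseteq> I \<and> measure lborel I \<le> measure lborel J + 2 * mesh T"
proof (cases "J = {}")
  case True
  then show ?thesis using mesh_pos[OF assms(1)] by (auto intro!: bexI[OF _ empty_in_grid])
next
  case False
  note m = mesh_pos[OF assms(1)]
  define a where "a = Inf J"
  define b where "b = Sup J"
  have bdd: "bdd_below J" "bdd_above J" using assms(3) by (meson bdd_below_Icc bdd_above_Icc bdd_below_mono bdd_above_mono)+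
  have J: "J \<subseteq> {a..b}" using bdd by (auto simp: a_def b_def intro: cInf_lower cSup_upper)
  have a0: "0 \<le> a" using False assms(3) by (auto simp: a_def intro!: cInf_greatest)
  have b1: "b \<le> 1" using False assms(3) by (auto simp: b_def intro!: cSup_least)
  have ab: "a \<le> b" using J False by fastforce
  \<comment> \<open>Whichever endpoints J contains, the open interval lies inside it, which bounds
    the length of J from below by b - a.\<close>
  have "{a<..<b} \<subseteq> J"
  proof
    fix x assume x: "x \<in> {a<..<b}"
    obtain c where c: "c \<in> J" "c < x" using x False bdd by (auto simp: a_def cInf_less_iff)
    obtain d where d: "d \<in> J" "x < d" using x False bdd by (auto simp: b_def less_cSup_iff)
    show "x \<in> J" using assms(2) c d by (meson is_interval_1 less_imp_le)
  qed
  then have "measure lborel {a<..<b} \<le> measure lborel J"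
    by (rule measure_mono_fmeasurable)
      (use assms is_interval_borel in \<open>simp_all add: fmeasurable_unit\<close>)
  then have len: "b - a \<le> measure lborel J" using ab by simp
  define a' where "a' = real (nat \<lfloor>a / mesh T\<rfloor>) * mesh T"
  \<comment> \<open>The next multiple of the mesh may exceed 1; the cap is harmless because 1 is
    always a grid point.\<close>
  define b' where "b' = min 1 (real (nat \<lceil>b / mesh T\<rceil>) * mesh T)"
  have fl: "real (nat \<lfloor>a / mesh T\<rfloor>) = of_int \<lfloor>a / mesh T\<rfloor>" using a0 m by simp
  have ce: "real (nat \<lceil>b / mesh T\<rceil>) = of_int \<lceil>b / mesh T\<rceil>" using a0 ab m by simp
  have a': "a' \<le> a" "a - mesh T \<le> a'" "0 \<le> a'"
  proof -
    have "of_int \<lfloor>a / mesh T\<rfloor> \<le> a / mesh T" by simp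
    then show "a' \<le> a" unfolding a'_def fl pos_le_divide_eq[OF m] .
    have "a / mesh T - 1 \<le> of_int \<lfloor>a / mesh T\<rfloor>" by linarith
    then show "a - mesh T \<le> a'" using m unfolding a'_def fl by (simp add: field_simps)
    show "0 \<le> a'" using m by (simp add: a'_def)
  qed
  have b': "b \<le> b'" "b' \<le> b + mesh T" "b' \<le> 1"
  proof -
    have "b / mesh T \<le> of_int \<lceil>b / mesh T\<rceil>" by simp
    then show "b \<le> b'" using b1 unfolding b'_def ce pos_divide_le_eq[OF m] by simp
    have "of_int \<lceil>b / mesh T\<rceil> \<le> b / mesh T + 1" by linarith
    then show "b' \<le> b + mesh T" using m unfolding b'_def ce by (simp add: field_simps min_le_iff_disj)
    show "b' \<le> 1" by (simp add: b'_def)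
  qed
  have "a' \<in> grid_points T" using a' ab b1 by (auto simp: grid_points_def a'_def)
  moreover have "b' = 1 \<or> (\<exists>k. b' = real k * mesh T)"
    unfolding b'_def min_def by metis
  then have "b' \<in> grid_points T"
    using b' a0 ab unfolding grid_points_def by simp
  ultimately have "{a'..b'} \<in> grid_intervals T"
    using a' b' ab by (intro Icc_in_grid) auto
  moreover have "J \<subseteq> {a'..b'}" using J a' b' by fastforce
  moreover have "measure lborel {a'..b'} \<le> measure lborel J + 2 * mesh T"
    using a' b' ab len by simp
  ultimately show ?thesis by blast
qed

section \<open>Bounds on the optimal cost\<close>

lemma unit_distribution_space: "unit_distribution D \<Longrightarrow> space D = UNIV"
  unfolding unit_distribution_def by (metis sets_eq_imp_space_eq space_borel)

text \<open>Fubini, with the membership event measurable by \<open>random_interval\<close>. The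
  coverage constraint thereby becomes linear in \<nu>, as Lagrangian duality requires.\<close>

lemma
  assumes \<nu>: "random_interval \<nu> (\<lambda>I. I)" and D: "unit_distribution D"
  shows integrable_coverage: "integrable \<nu> (\<lambda>I. measure D I)"
    and coverage_eq_integral:
      "measure (\<nu> \<Otimes>\<^sub>M D) {z \<in> space (\<nu> \<Otimes>\<^sub>M D). snd z \<in> fst z} = (\<integral>I. measure D I \<partial>\<nu>)"
proof -
  have sD: "sets D = sets borel" using D by (simp add: unit_distribution_def)
  interpret \<nu>: prob_space \<nu> using \<nu> by (simp add: random_interval_def)
  interpret D: prob_space D using D by (simp add: unit_distribution_def)
  interpret P: pair_prob_space \<nu> D ..
  let ?A = "{z \<in> space (\<nu> \<Otimes>\<^sub>M D). snd z \<in> fst z}"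
  have "Measurable.pred (\<nu> \<Otimes>\<^sub>M D) (\<lambda>z. snd z \<in> fst z)"
    using \<nu> by (simp add: random_interval_def measurable_cong_sets[OF sets_pair_measure_cong[OF refl sD] refl])
  then have A: "?A \<in> sets (\<nu> \<Otimes>\<^sub>M D)" unfolding pred_def .
  have int: "integrable (\<nu> \<Otimes>\<^sub>M D) (indicator ?A :: _ \<Rightarrow> real)"
    using A by (intro P.P.integrable_const_bound[of _ 1]) auto
  have inner: "(\<integral>y. indicator ?A (I, y) \<partial>D) = measure D I" if I: "I \<in> space \<nu>" for I
  proof -
    have "(\<lambda>y. indicator ?A (I, y) :: real) = indicator I"
      using I unit_distribution_space[OF D] by (auto simp: indicator_def space_pair_measure)
    moreover have "I \<in> sets D"
      using \<nu> I sD by (auto simp: random_interval_def intro: is_interval_borel)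
    ultimately show ?thesis by (simp add: D.emeasure_eq_measure)
  qed
  show "integrable \<nu> (\<lambda>I. measure D I)"
    using P.integrable_fst'[OF int] by (rule Bochner_Integration.integrable_cong[THEN iffD1, OF refl, rotated]) (rule inner)
  have "measure (\<nu> \<Otimes>\<^sub>M D) ?A = integral\<^sup>L (\<nu> \<Otimes>\<^sub>M D) (indicator ?A)"
    using A by simp
  also have "\<dots> = (\<integral>I. measure D I \<partial>\<nu>)"
    unfolding P.integral_fst'[OF int, symmetric] by (intro Bochner_Integration.integral_cong refl inner)
  finally show "measure (\<nu> \<Otimes>\<^sub>M D) ?A = (\<integral>I. measure D I \<partial>\<nu>)" .
qed

lemma integrable_cost:
  assumes "random_interval \<nu> (\<lambda>I. I)"
  shows "integrable \<nu> (\<lambda>I. measure lborel I)"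
proof -
  interpret prob_space \<nu> using assms by (simp add: random_interval_def)
  show ?thesis
    using assms by (intro integrable_const_bound[of _ 1])
      (auto simp: random_interval_def measure_lborel_unit_le_one)
qed

text \<open>On a finite discrete space, joint measurability of membership reduces to the sections,
  which are intervals and hence Borel.\<close>

lemma finite_random_interval:
  fixes w :: "real set \<Rightarrow> real"
  assumes fin: "finite G" and G: "\<And>I. I \<in> G \<Longrightarrow> is_interval I \<and> I \<subseteq> {0..1}"
    and w: "\<And>I. I \<in> G \<Longrightarrow> 0 \<le> w I" and w1: "(\<Sum>I\<in>G. w I) = 1"
  shows "random_interval (point_measure G w) (\<lambda>I. I)"
proof -
  have "emeasure (point_measure G w) (space (point_measure G w)) = 1"
    using fin w w1 by (simp add: emeasure_point_measure_finite2 space_point_measure sum_ennreal)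
  then have "prob_space (point_measure G w)" by (rule prob_spaceI)
  moreover have "Measurable.pred (point_measure G w \<Otimes>\<^sub>M borel) (\<lambda>z. snd z \<in> fst z)"
  proof -
    have "Measurable.pred (count_space G \<Otimes>\<^sub>M borel) (\<lambda>z. snd z \<in> fst z)"
      using fin G by (intro measurable_pair_measure_countable1)
        (auto simp: countable_finite pred_def is_interval_borel)
    then show ?thesis
      by (simp add: measurable_cong_sets[OF sets_pair_measure_cong[OF sets_point_measure_count_space refl] refl])
  qed
  ultimately show ?thesis
    using G fin by (simp add: random_interval_def space_point_measure)
qed

text \<open>Any admissible law bounds the infimum from above. The competitor used later is the time
  average of the played laws mixed with [0,1].\<close>

lemma optimal_cost_le_mixture:
  fixes w :: "real set \<Rightarrow> real"
  assumes D: "unit_distribution D"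
    and fin: "finite G" and G: "\<And>I. I \<in> G \<Longrightarrow> is_interval I \<and> I \<subseteq> {0..1}"
    and w: "\<And>I. I \<in> G \<Longrightarrow> 0 \<le> w I" and w1: "(\<Sum>I\<in>G. w I) = 1"
    and cov: "\<phi> \<le> (\<Sum>I\<in>G. w I * measure D I)"
  shows "optimal_cost D \<phi> \<le> (\<Sum>I\<in>G. w I * measure lborel I)"
proof -
  let ?\<nu> = "point_measure G w"
  have \<nu>: "random_interval ?\<nu> (\<lambda>I. I)" by (rule finite_random_interval[OF fin G w w1])
  have int: "(\<integral>I. f I \<partial>?\<nu>) = (\<Sum>I\<in>G. w I * f I)" for f :: "real set \<Rightarrow> real"
    using lebesgue_integral_point_measure_finite[where g = f, OF fin w] by simp
  have "optimal_cost D \<phi> \<le> (\<integral>I. measure lborel I \<partial>?\<nu>)"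
    unfolding optimal_cost_def
  proof (rule cInf_lower)
    show "bdd_below {(\<integral>I. measure lborel I \<partial>\<nu>) | \<nu> :: real set measure. random_interval \<nu> (\<lambda>I. I) \<and>
            measure (\<nu> \<Otimes>\<^sub>M D) {z \<in> space (\<nu> \<Otimes>\<^sub>M D). snd z \<in> fst z} \<ge> \<phi>}"
      by (rule bdd_belowI[of _ 0]) auto
    show "(\<integral>I. measure lborel I \<partial>?\<nu>) \<in> {(\<integral>I. measure lborel I \<partial>\<nu>) | \<nu> :: real set measure. random_interval \<nu> (\<lambda>I. I) \<and>
            measure (\<nu> \<Otimes>\<^sub>M D) {z \<in> space (\<nu> \<Otimes>\<^sub>M D). snd z \<in> fst z} \<ge> \<phi>}"
      using \<nu> cov by (auto simp: coverage_eq_integral[OF \<nu> D] int intro!: exI[of _ ?\<nu>])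
  qed
  then show ?thesis unfolding int .
qed

lemma optimal_cost_ge:
  assumes D: "unit_distribution D" and \<phi>: "\<phi> \<le> 1" and \<mu>: "0 \<le> \<mu>"
    and le: "\<And>J. is_interval J \<Longrightarrow> J \<subseteq> {0..1} \<Longrightarrow> c \<le> measure lborel J - \<mu> * (measure D J - \<phi>)"
  shows "c \<le> optimal_cost D \<phi>"
  unfolding optimal_cost_def
proof (rule cInf_greatest)
  \<comment> \<open>The point mass at [0,1] is admissible, so the infimum is over a nonempty set;
    \<open>Inf\<close> of the empty set of reals would carry no information.\<close>
  let ?w = "\<lambda>_ :: real set. 1 :: real"
  let ?\<nu> = "point_measure {{0..1::real}} ?w"
  have \<nu>: "random_interval ?\<nu> (\<lambda>I. I)"
    by (rule finite_random_interval) (simp_all add: is_interval_cc)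
  have "(\<integral>I. measure D I \<partial>?\<nu>) = measure D {0..1}"
    by (subst lebesgue_integral_point_measure_finite) simp_all
  then have "measure (?\<nu> \<Otimes>\<^sub>M D) {z \<in> space (?\<nu> \<Otimes>\<^sub>M D). snd z \<in> fst z} \<ge> \<phi>"
    unfolding coverage_eq_integral[OF \<nu> D] using D \<phi> by (simp add: unit_distribution_def)
  then show "{(\<integral>I. measure lborel I \<partial>\<nu>) | \<nu> :: real set measure. random_interval \<nu> (\<lambda>I. I) \<and>
      measure (\<nu> \<Otimes>\<^sub>M D) {z \<in> space (\<nu> \<Otimes>\<^sub>M D). snd z \<in> fst z} \<ge> \<phi>} \<noteq> {}"
    using \<nu> by blast
next
  fix x
  assume "x \<in> {(\<integral>I. measure lborel I \<partial>\<nu>) | \<nu> :: real set measure. random_interval \<nu> (\<lambda>I. I) \<and>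
      measure (\<nu> \<Otimes>\<^sub>M D) {z \<in> space (\<nu> \<Otimes>\<^sub>M D). snd z \<in> fst z} \<ge> \<phi>}"
  then obtain \<nu> :: "real set measure" where \<nu>: "random_interval \<nu> (\<lambda>I. I)"
    and x: "x = (\<integral>I. measure lborel I \<partial>\<nu>)" and cov: "\<phi> \<le> (\<integral>I. measure D I \<partial>\<nu>)"
    using coverage_eq_integral[OF _ D] by auto
  interpret prob_space \<nu> using \<nu> by (simp add: random_interval_def)
  note [intro!, simp] = integrable_cost[OF \<nu>] integrable_coverage[OF \<nu> D]
  have "c = (\<integral>I. c \<partial>\<nu>)" by (simp add: prob_space)
  also have "\<dots> \<le> (\<integral>I. measure lborel I - \<mu> * (measure D I - \<phi>) \<partial>\<nu>)"
    using \<nu> le by (intro integral_mono) (auto simp: random_interval_def)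
  also have "\<dots> = x - \<mu> * ((\<integral>I. measure D I \<partial>\<nu>) - \<phi>)"
    by (simp add: x prob_space)
  also have "\<dots> \<le> x" using \<mu> cov by simp
  finally show "c \<le> x" .
qed

lemma optimal_cost_nonneg:
  "unit_distribution D \<Longrightarrow> \<phi> \<le> 1 \<Longrightarrow> 0 \<le> optimal_cost D \<phi>"
  by (rule optimal_cost_ge[where \<mu> = 0]) simp_all

section \<open>The law of the observed bits\<close>

lemma length_feedback [simp]: "length (feedback p y t) = t"
  by (induction t) simp_all

lemma take_feedback: "s \<le> t \<Longrightarrow> take s (feedback p y t) = feedback p y s"
  by (induction t) (auto simp: le_Suc_eq)

lemma feedback_cong:
  "(\<And>s. s \<in> {1..t} \<Longrightarrow> y s = z s) \<Longrightarrow> feedback p y t = feedback p z t"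
  by (induction t) auto

locale bandit_run = prob_space D
  for D :: "real measure" +
  fixes p :: "bool list \<Rightarrow> real set" and T :: nat
  assumes sets_D [measurable_cong]: "sets D = sets borel"
    and p_borel [measurable]: "\<And>h. p h \<in> sets borel"
begin

abbreviation points :: "(nat \<Rightarrow> real) measure" where
  "points \<equiv> \<Pi>\<^sub>M t\<in>{1..T}. D"

text \<open>The law of the history of length t is used through this functional rather than as a
  measure on lists. For t > T the feedback would read coordinates outside {1..T}, whence the
  conditions t \<le> T below.\<close>

definition expect :: "(bool list \<Rightarrow> real) \<Rightarrow> nat \<Rightarrow> real" where
  "expect F t = (\<integral>y. F (feedback p y t) \<partial>points)"

sublocale Points: product_prob_space "\<lambda>_. D" "{1..T}"
  by unfold_locales

lemma prob_space_history: "prob_space (\<Pi>\<^sub>M i\<in>K. D)"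
  by (intro prob_space_PiM prob_space_axioms)

text \<open>Bit lists are countable, so the next bit can be treated separately for each past h. K is
  left general because \<open>expect_Suc\<close> removes one coordinate.\<close>

lemma measurable_feedback:
  assumes "{1..t} \<subseteq> K"
  shows "(\<lambda>y. feedback p y t) \<in> measurable (\<Pi>\<^sub>M i\<in>K. D) (count_space UNIV)"
  using assms
proof (induction t)
  case (Suc t)
  have "Suc t \<in> K" using Suc.prems by auto
  then have "(\<lambda>y. y (Suc t)) \<in> measurable (\<Pi>\<^sub>M i\<in>K. D) borel"
    by (simp flip: measurable_cong_sets[OF refl sets_D] add: measurable_component_singleton)
  then have "Measurable.pred (\<Pi>\<^sub>M i\<in>K. D) (\<lambda>y. y (Suc t) \<in> p h)" for h
    using p_borel by (rule pred_sets2[rotated])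
  then have "(\<lambda>y. h @ [y (Suc t) \<in> p h]) \<in> measurable (\<Pi>\<^sub>M i\<in>K. D) (count_space UNIV)" for h
    by (rule measurable_compose) simp
  moreover have "(\<lambda>y. feedback p y t) \<in> measurable (\<Pi>\<^sub>M i\<in>K. D) (count_space UNIV)"
    using Suc by (auto simp: subset_eq)
  ultimately show ?case
    unfolding feedback.simps by (rule measurable_compose_countable)
qed simp

text \<open>Only finitely many bit lists have length t, so any F is bounded on them.\<close>

lemma integrable_feedback:
  assumes "{1..t} \<subseteq> K"
  shows "integrable (\<Pi>\<^sub>M i\<in>K. D) (\<lambda>y. F (feedback p y t) :: real)"
proof -
  interpret H: prob_space "\<Pi>\<^sub>M i\<in>K. D" by (rule prob_space_history)
  have fin: "finite {h :: bool list. length h = t}"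
    using finite_lists_length_eq[of "UNIV :: bool set" t] by simp
  then have "\<bar>F (feedback p y t)\<bar> \<le> Max ((\<lambda>h. \<bar>F h\<bar>) ` {h. length h = t})" for y
    by (intro Max_ge) auto
  moreover have "(\<lambda>y. F (feedback p y t)) \<in> borel_measurable (\<Pi>\<^sub>M i\<in>K. D)"
    by (rule measurable_compose[OF measurable_feedback[OF assms]]) simp
  ultimately show ?thesis
    by (intro H.integrable_const_bound) auto
qed

lemma expect_mono:
  assumes "t \<le> T" "\<And>h. length h = t \<Longrightarrow> F h \<le> G h"
  shows "expect F t \<le> expect G t"
  unfolding expect_def using assms by (intro integral_mono integrable_feedback) auto

lemma
  assumes "t \<le> T"
  shows expect_add: "expect (\<lambda>h. F h + G h) t = expect F t + expect G t"
    and expect_diff: "expect (\<lambda>h. F h - G h) t = expect F t - expect G t"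
    and expect_cmult: "expect (\<lambda>h. c * F h) t = c * expect F t"
    and expect_const: "expect (\<lambda>h. c) t = c"
    and expect_sum: "expect (\<lambda>h. \<Sum>i\<in>A. f i h) t = (\<Sum>i\<in>A. expect (f i) t)"
  using assms unfolding expect_def
  by (simp_all add: integrable_feedback prob_space.prob_space[OF prob_space_history])

text \<open>The point at step \<open>Suc t\<close> is independent of the first t bits. Integrating
  it out by Fubini leaves a Bernoulli bit with parameter \<open>prob (p h)\<close>.\<close>

lemma expect_Suc:
  assumes "t < T"
  shows "expect F (Suc t) =
    expect (\<lambda>h. prob (p h) * F (h @ [True]) + (1 - prob (p h)) * F (h @ [False])) t"
    (is "_ = expect ?G t")
proof -
  define K where "K = {1..T} - {Suc t}"
  have K: "finite K" "Suc t \<notin> K" "insert (Suc t) K = {1..T}" "{1..t} \<subseteq> K"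
    using assms by (auto simp: K_def)
  have past: "feedback p (x(Suc t := y)) t = feedback p x t" for x y
    by (rule feedback_cong) auto
  have inner: "(\<integral>y. F (h @ [y \<in> p h]) \<partial>D) = ?G h" for h
  proof -
    have "F (h @ [y \<in> p h]) = F (h @ [False]) + (F (h @ [True]) - F (h @ [False])) * indicator (p h) y" for y
      by (simp add: indicator_def)
    moreover have "integrable D (indicator (p h) :: _ \<Rightarrow> real)"
      by (rule integrable_const_bound[of _ 1]) (auto simp: measurable_cong_sets[OF sets_D refl])
    moreover have "space D = UNIV"
      using sets_eq_imp_space_eq[OF sets_D] by simp
    ultimately have "(\<integral>y. F (h @ [y \<in> p h]) \<partial>D) =
        F (h @ [False]) + (F (h @ [True]) - F (h @ [False])) * prob (p h)"
      using prob_space by simp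
    then show ?thesis by (simp add: algebra_simps)
  qed
  have "expect F (Suc t) = (\<integral>x. (\<integral>y. F (feedback p (x(Suc t := y)) (Suc t)) \<partial>D) \<partial>(\<Pi>\<^sub>M i\<in>K. D))"
    unfolding expect_def K(3)[symmetric] using assms K
    by (intro Points.product_integral_insert integrable_feedback) auto
  also have "\<dots> = (\<integral>x. ?G (feedback p x t) \<partial>(\<Pi>\<^sub>M i\<in>K. D))"
    by (simp add: past inner)
  \<comment> \<open>The integrand ignores y, so an integral over the probability measure D can be
    reinserted to return to the full product.\<close>
  also have "\<dots> = (\<integral>x. (\<integral>y. ?G (feedback p (x(Suc t := y)) t) \<partial>D) \<partial>(\<Pi>\<^sub>M i\<in>K. D))"
    by (simp add: past prob_space)
  also have "\<dots> = expect ?G t"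
    unfolding expect_def K(3)[symmetric] using assms K
    by (intro Points.product_integral_insert[symmetric] integrable_feedback) auto
  finally show ?thesis .
qed

lemma expect_0: "expect F 0 = F []"
  by (simp add: expect_def prob_space.prob_space[OF prob_space_history])

end

section \<open>The policy and its pathwise validity\<close>

definition anchored :: "nat \<Rightarrow> real set set" where
  "anchored T = (\<lambda>x. {0..x}) ` grid_points T \<union> (\<lambda>x. {x..1}) ` grid_points T"

lemma anchored_subset_grid: "anchored T \<subseteq> grid_intervals T"
proof -
  have "{0..x} \<in> grid_intervals T \<and> {x..1} \<in> grid_intervals T" if "x \<in> grid_points T" for x
    using that grid_points_unit[of T] zero_one_grid[of T] Icc_in_grid by fastforce
  then show ?thesis by (auto simp: anchored_def)
qed

lemma anchored_nonempty: "anchored T \<noteq> {}"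
  using zero_one_grid[of T] by (auto simp: anchored_def)

lemma
  assumes "T \<ge> 1"
  shows finite_anchored: "finite (anchored T)"
    and card_anchored: "real (card (anchored T)) \<le> 6 / mesh T"
proof -
  note fin = finite_grid_points[OF assms]
  show "finite (anchored T)" using fin by (simp add: anchored_def)
  have "card (anchored T) \<le> card (grid_points T) + card (grid_points T)"
    unfolding anchored_def using fin
    by (intro order_trans[OF card_Un_le] add_mono card_image_le) auto
  then have "real (card (anchored T)) \<le> 2 * real (card (grid_points T))"
    by linarith
  also have "\<dots> \<le> 2 * (2 + 1 / mesh T)"
    using card_grid_points[OF assms] by simp
  also have "\<dots> \<le> 6 / mesh T"
    using mesh_pos[OF assms] mesh_le_one[OF assms] by (simp add: field_simps)
  finally show "real (card (anchored T)) \<le> 6 / mesh T" .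
qed

section \<open>Dual ascent with forced moves and block probing\<close>

locale dual_bandit =
  fixes T :: nat and \<phi> :: real
  assumes T_ge_2: "2 \<le> T" and \<phi>_pos: "0 < \<phi>" and \<phi>_less_1: "\<phi> < 1"
begin

lemma T_ge_1: "1 \<le> T"
  using T_ge_2 by simp

definition \<eta> :: real where "\<eta> = 1 / sqrt (real T)"
definition \<Lambda> :: real where "\<Lambda> = 1 / (1 - \<phi>)"

lemma \<eta>_pos: "0 < \<eta>"
  using T_ge_2 by (simp add: \<eta>_def)

lemma \<Lambda>_ge_1: "1 \<le> \<Lambda>"
  using \<phi>_pos \<phi>_less_1 by (simp add: \<Lambda>_def)

text \<open>The dual ascent iterate in closed form; it depends on the bits alone and is thus
  available under bandit feedback.\<close>

definition lam :: "bool list \<Rightarrow> real" where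
  "lam h = \<eta> * (\<Sum>b\<leftarrow>h. \<phi> - of_bool b)"

lemma lam_Nil [simp]: "lam [] = 0"
  by (simp add: lam_def)

lemma lam_snoc [simp]: "lam (h @ [b]) = lam h + \<eta> * (\<phi> - of_bool b)"
  by (simp add: lam_def algebra_simps)

definition free :: "bool list \<Rightarrow> bool" where
  "free h \<longleftrightarrow> 0 \<le> lam h \<and> lam h \<le> \<Lambda>"

text \<open>Only earlier free steps count, so a forced move suspends the probing schedule instead of
  consuming a slot of it.\<close>

definition rounds :: "bool list \<Rightarrow> nat" where
  "rounds h = (\<Sum>s<length h. of_bool (free (take s h)))"

definition reps :: nat where
  "reps = nat \<lceil>sqrt (real T)\<rceil>"

definition budget :: nat where
  "budget = card (anchored T) * reps"

definition exploring :: "bool list \<Rightarrow> bool" where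
  "exploring h \<longleftrightarrow> free h \<and> rounds h < budget"

text \<open>The j-th block of \<open>reps\<close> free rounds is devoted to the j-th anchored
  interval. Past the budget \<open>from_nat_into\<close> returns an unspecified member of
  \<open>anchored T\<close>, so \<open>probe_anchored\<close> holds for every h.\<close>

definition probe :: "bool list \<Rightarrow> real set" where
  "probe h = from_nat_into (anchored T) (rounds h div reps)"

text \<open>Forced and committed plays of A are left out, although [0,1] itself is anchored. This
  makes the number of counted samples deterministic once probing is over.\<close>

definition pulls :: "bool list \<Rightarrow> real set \<Rightarrow> nat" where
  "pulls h A = (\<Sum>s<length h. of_bool (exploring (take s h) \<and> probe (take s h) = A))"

definition hits :: "bool list \<Rightarrow> real set \<Rightarrow> nat" where
  "hits h A = (\<Sum>s<length h. of_bool (exploring (take s h) \<and> probe (take s h) = A \<and> h ! s))"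

text \<open>\<open>Inf\<close> and \<open>Sup\<close> recover the endpoints of a nonempty grid
  interval; the empty one has none and is set to its true coverage 0. Division by
  \<open>reps\<close> is the right normalization only once probing is complete.\<close>

definition est :: "bool list \<Rightarrow> real set \<Rightarrow> real" where
  "est h I = (if I = {} then 0
     else real (hits h {0..Sup I}) / reps + real (hits h {Inf I..1}) / reps - 1)"

definition policy :: "bool list \<Rightarrow> real set" where
  "policy h =
     (if lam h < 0 then {}
      else if \<Lambda> < lam h then {0..1}
      else if rounds h < budget then probe h
      else arg_min_on (\<lambda>I. measure lborel I - lam h * est h I) (grid_intervals T))"

lemma policy_low: "lam h < 0 \<Longrightarrow> policy h = {}"
  by (simp add: policy_def)

lemma policy_high: "\<Lambda> < lam h \<Longrightarrow> policy h = {0..1}"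
  using \<Lambda>_ge_1 by (simp add: policy_def)

lemma policy_exploring: "exploring h \<Longrightarrow> policy h = probe h"
  by (simp add: policy_def exploring_def free_def)

lemma policy_committed:
  "free h \<Longrightarrow> \<not> exploring h \<Longrightarrow>
    policy h = arg_min_on (\<lambda>I. measure lborel I - lam h * est h I) (grid_intervals T)"
  by (auto simp: policy_def exploring_def free_def)

lemma probe_anchored: "probe h \<in> anchored T"
  unfolding probe_def by (rule from_nat_into) (rule anchored_nonempty)

lemma policy_in_grid: "policy h \<in> grid_intervals T"
proof -
  have "arg_min_on f (grid_intervals T) \<in> grid_intervals T" for f :: "_ \<Rightarrow> real"
    using finite_grid_intervals[OF T_ge_1] empty_in_grid by (intro arg_min_if_finite) auto
  moreover have "{0..1} \<in> grid_intervals T"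
    by (intro Icc_in_grid zero_one_grid) simp
  ultimately show ?thesis
    using empty_in_grid[of T] subsetD[OF anchored_subset_grid probe_anchored]
    by (simp add: policy_def)
qed

lemmas policy_borel = grid_interval_borel[OF policy_in_grid]
lemmas policy_is_interval = grid_interval_is_interval[OF policy_in_grid]
lemmas policy_unit = grid_interval_unit[OF policy_in_grid]

text \<open>Outside [0, \<Lambda>] the forced interval determines the bit and pushes the multiplier
  back; inside, one step moves it by at most \<eta>.\<close>

lemma lam_feedback_bounds:
  assumes "\<And>s. s \<in> {1..t} \<Longrightarrow> y s \<in> {0..1}"
  shows "- \<eta> \<le> lam (feedback policy y t) \<and> lam (feedback policy y t) \<le> \<Lambda> + \<eta>"
  using assms
proof (induction t)
  case 0
  show ?case using \<eta>_pos \<Lambda>_ge_1 by simp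
next
  case (Suc t)
  define h where "h = feedback policy y t"
  define b where "b = (y (Suc t) \<in> policy h)"
  have IH: "- \<eta> \<le> lam h" "lam h \<le> \<Lambda> + \<eta>"
    using Suc by (auto simp: h_def)
  have unit: "y (Suc t) \<in> {0..1}" using Suc.prems by simp
  have step: "0 \<le> \<eta> * \<phi>" "\<eta> * \<phi> \<le> \<eta>"
    using \<eta>_pos \<phi>_pos \<phi>_less_1 mult_left_le[of \<phi> \<eta>] by simp_all
  have e: "\<eta> * (\<phi> - of_bool b) = (if b then \<eta> * \<phi> - \<eta> else \<eta> * \<phi>)"
    by (simp add: algebra_simps)
  consider "lam h < 0" | "\<Lambda> < lam h" | "0 \<le> lam h" "lam h \<le> \<Lambda>" by linarith
  then have "- \<eta> \<le> lam h + \<eta> * (\<phi> - of_bool b) \<and> lam h + \<eta> * (\<phi> - of_bool b) \<le> \<Lambda> + \<eta>"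
  proof cases
    case 1
    then have "\<not> b" by (simp add: b_def policy_low)
    then show ?thesis unfolding e using 1 IH step \<Lambda>_ge_1 by (intro conjI; simp only: if_False; linarith)
  next
    case 2
    then have "b" using unit by (simp add: b_def policy_high)
    then show ?thesis unfolding e using 2 IH step \<Lambda>_ge_1 by (intro conjI; simp only: if_True; linarith)
  next
    case 3
    then show ?thesis unfolding e using step by (intro conjI; cases b; simp only: if_True if_False; linarith)
  qed
  then show ?case by (simp add: h_def b_def)
qed

lemma covered_eq_lam_decrement:
  "\<eta> * (covered policy y (Suc t) - \<phi>) = lam (feedback policy y t) - lam (feedback policy y (Suc t))"
  by (simp add: covered_def chosen_def algebra_simps)

text \<open>Telescoping. Step \<open>Suc t\<close> is played on the history of length t, so a window
  from \<open>Suc l\<close> starts at the multiplier after l steps.\<close>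

lemma sum_covered_eq:
  "\<eta> * (\<Sum>t=Suc l..l + L. covered policy y t - \<phi>) =
    lam (feedback policy y l) - lam (feedback policy y (l + L))"
proof (induction L)
  case (Suc L)
  then show ?case
    using covered_eq_lam_decrement[of y "l + L"] by (simp add: distrib_left del: feedback.simps)
qed simp

lemma covered_sum_deviation:
  assumes "\<And>s. s \<in> {1..l + L} \<Longrightarrow> y s \<in> {0..1}"
  shows "\<bar>\<Sum>t=Suc l..l + L. covered policy y t - \<phi>\<bar> \<le> (\<Lambda> + 2 * \<eta>) / \<eta>"
proof -
  have "\<eta> * \<bar>\<Sum>t=Suc l..l + L. covered policy y t - \<phi>\<bar> =
      \<bar>lam (feedback policy y l) - lam (feedback policy y (l + L))\<bar>"
    unfolding sum_covered_eq[symmetric] using \<eta>_pos by (simp add: abs_mult)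
  also have "\<dots> \<le> \<Lambda> + 2 * \<eta>"
    using lam_feedback_bounds[of l y] lam_feedback_bounds[of "l + L" y] assms by force
  finally show ?thesis using \<eta>_pos by (simp add: field_simps)
qed

lemma pathwise_validity:
  assumes y: "y \<in> {1..T} \<rightarrow> {0..1}" and L: "L \<ge> 1" and l: "{l..l + L - 1} \<subseteq> {1..T}"
  shows "\<bar>1 / real L * (\<Sum>t=l..l + L - 1. covered policy y t) - \<phi>\<bar> \<le> (\<Lambda> + 2 * \<eta>) / (\<eta> * real L)"
proof -
  have "l \<in> {1..T}" using L by (intro subsetD[OF l]) auto
  then obtain l' where l': "l = Suc l'" by (cases l) auto
  have "l + L - 1 \<in> {1..T}" using l L by (intro subsetD[OF l]) auto
  then have "\<bar>\<Sum>t=l..l + L - 1. covered policy y t - \<phi>\<bar> \<le> (\<Lambda> + 2 * \<eta>) / \<eta>"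
    using covered_sum_deviation[of l' L y] y l' by (simp add: Pi_iff)
  moreover have "1 / real L * (\<Sum>t=l..l + L - 1. covered policy y t) - \<phi> =
      (\<Sum>t=l..l + L - 1. covered policy y t - \<phi>) / real L"
    using L l' by (simp add: sum_subtractf field_simps)
  ultimately show ?thesis
    using L by (simp add: abs_divide divide_right_mono flip: divide_divide_eq_left)
qed

end

section \<open>Exploration and concentration\<close>

text \<open>For x = -y < 0, the product of 1 - y + y^2 with the quadratic Taylor lower bound of exp
  y is at least 1, and dividing by exp y gives the claim.\<close>

lemma exp_le_quadratic:
  fixes x :: real
  assumes "\<bar>x\<bar> \<le> 1"
  shows "exp x \<le> 1 + x + x\<^sup>2"
proof (cases "0 \<le> x")
  case True
  then show ?thesis using assms by (intro exp_bound) auto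
next
  case False
  define y where "y = - x"
  have y: "0 \<le> y" using False by (simp add: y_def)
  have "1 + y + y\<^sup>2 / 2 \<le> exp y" by (rule exp_lower_Taylor_quadratic[OF y])
  moreover have "0 \<le> 1 - y + y\<^sup>2" using assms y by (simp add: y_def)
  ultimately have prod: "(1 - y + y\<^sup>2) * (1 + y + y\<^sup>2 / 2) \<le> (1 - y + y\<^sup>2) * exp y"
    by (intro mult_left_mono)
  have eq: "(1 - y + y\<^sup>2) * (1 + y + y\<^sup>2 / 2) = 1 + (y\<^sup>2 + y ^ 3 + y ^ 4) / 2"
    by (simp add: field_simps power2_eq_square power3_eq_cube power4_eq_xxxx)
  have "1 \<le> 1 + (y\<^sup>2 + y ^ 3 + y ^ 4) / 2" using y by simp
  also have "\<dots> \<le> (1 - y + y\<^sup>2) * exp y" using prod unfolding eq .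
  finally have "1 \<le> (1 - y + y\<^sup>2) * exp y" .
  then have "exp (- y) \<le> 1 - y + y\<^sup>2"
    by (simp add: exp_minus field_simps)
  then show ?thesis by (simp add: y_def)
qed

text \<open>Centring cancels the linear terms and leaves s^2 times the variance q (1 - q) \<le> 1.
  Hoeffding's constant 1/8 would be sharper, but only logarithms and constants are at stake.\<close>

lemma bernoulli_mgf_le:
  fixes s q :: real
  assumes "\<bar>s\<bar> \<le> 1" "0 \<le> q" "q \<le> 1"
  shows "q * exp (s * (1 - q)) + (1 - q) * exp (- (s * q)) \<le> exp (s\<^sup>2)"
proof -
  have b: "\<bar>s * (1 - q)\<bar> \<le> 1" "\<bar>- (s * q)\<bar> \<le> 1"
    using assms by (simp_all add: abs_mult mult_le_one)
  have "q * exp (s * (1 - q)) + (1 - q) * exp (- (s * q)) \<le>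
      q * (1 + s * (1 - q) + (s * (1 - q))\<^sup>2) + (1 - q) * (1 + - (s * q) + (- (s * q))\<^sup>2)"
    using assms by (intro add_mono mult_left_mono exp_le_quadratic b) auto
  also have "\<dots> = 1 + s\<^sup>2 * (q * (1 - q))"
    by (simp add: algebra_simps power2_eq_square)
  also have "\<dots> \<le> 1 + s\<^sup>2 * 1"
    using assms by (intro add_left_mono mult_left_mono mult_le_one) auto
  also have "\<dots> \<le> exp (s\<^sup>2)" using exp_ge_add_one_self[of "s\<^sup>2"] by simp
  finally show ?thesis .
qed

text \<open>Replaces a union bound and a tail estimate: for suitable \<open>r\<close> and \<open>s\<close> the exponentials have
  small expectation.\<close>

lemma abs_le_threshold_plus_exp:
  fixes x r s :: real
  assumes "0 < s"
  shows "\<bar>x\<bar> \<le> r + (exp (s * (x - r)) + exp (s * (- x - r))) / s"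
proof -
  have "s * (z - r) \<le> exp (s * (z - r))" for z
    using exp_ge_add_one_self[of "s * (z - r)"] by linarith
  then have "z - r \<le> exp (s * (z - r)) / s" for z
    using assms by (simp add: pos_le_divide_eq mult.commute)
  then have "z \<le> r + exp (s * (z - r)) / s" for z
    by (metis add.commute diff_le_eq)
  moreover have "0 \<le> exp (s * (z - r)) / s" for z using assms by simp
  ultimately have "z \<le> r + exp (s * (z - r)) / s + exp (s * (w - r)) / s" for z w
    by (meson add_increasing2 order_trans le_add_same_cancel1)
  from this[of x "- x"] this[of "- x" x] show ?thesis
    by (simp add: add_divide_distrib abs_le_iff)
qed

text \<open>The common one-step recursion of the counters, each of which sums a function of a prefix
  and the bit that follows it.\<close>

lemma sum_prefixes_snoc:
  "(\<Sum>s<length (h @ [b]). f (take s (h @ [b])) ((h @ [b]) ! s)) =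
    (\<Sum>s<length h. f (take s h) (h ! s)) + (f h b :: nat)"
proof -
  have "(\<Sum>s<length h. f (take s (h @ [b])) ((h @ [b]) ! s)) = (\<Sum>s<length h. f (take s h) (h ! s))"
    by (rule sum.cong) (auto simp: nth_append)
  then show ?thesis by simp
qed

section \<open>Bookkeeping of the probing phase\<close>

context dual_bandit
begin

lemma rounds_Nil [simp]: "rounds [] = 0" by (simp add: rounds_def)
lemma pulls_Nil [simp]: "pulls [] A = 0" by (simp add: pulls_def)
lemma hits_Nil [simp]: "hits [] A = 0" by (simp add: hits_def)

lemma rounds_snoc: "rounds (h @ [b]) = rounds h + of_bool (free h)"
  unfolding rounds_def by (rule sum_prefixes_snoc)

lemma pulls_snoc: "pulls (h @ [b]) A = pulls h A + of_bool (exploring h \<and> probe h = A)"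
  unfolding pulls_def by (rule sum_prefixes_snoc)

lemma hits_snoc: "hits (h @ [b]) A = hits h A + of_bool (exploring h \<and> probe h = A \<and> b)"
  unfolding hits_def by (rule sum_prefixes_snoc)

text \<open>The count equals \<open>min (rounds h) budget\<close>, because every free step explores
  until the budget is spent.\<close>

lemma exploring_steps_le: "(\<Sum>s<length h. of_bool (exploring (take s h))) \<le> budget"
proof -
  have "(\<Sum>s<length h. of_bool (exploring (take s h))) = min (rounds h) budget"
  proof (induction h rule: rev_induct)
    case (snoc b h)
    have "(\<Sum>s<length (h @ [b]). of_bool (exploring (take s (h @ [b])))) =
        min (rounds h) budget + of_bool (exploring h)"
      using sum_prefixes_snoc[of "\<lambda>g _. of_bool (exploring g)"] snoc by simp
    then show ?case by (simp add: rounds_snoc exploring_def)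
  qed simp
  then show ?thesis by simp
qed

lemma reps_pos: "0 < reps"
  using T_ge_2 by (simp add: reps_def)

text \<open>Exploring steps are identified with the value k of \<open>rounds\<close> at which they
  occur, which turns a count over a history into a count of indices.\<close>

lemma pulls_eq_card:
  "pulls h A = card {k. k < min (rounds h) budget \<and> from_nat_into (anchored T) (k div reps) = A}"
    (is "_ = card (?S h)")
proof (induction h rule: rev_induct)
  case (snoc b h)
  have "?S (h @ [b]) = (if exploring h \<and> probe h = A then insert (rounds h) (?S h) else ?S h)"
    by (auto simp: rounds_snoc exploring_def probe_def less_Suc_eq)
  moreover have "finite (?S h)" "rounds h \<notin> ?S h" by auto
  ultimately show ?case using snoc by (simp add: pulls_snoc)
qed simp

definition committed :: "bool list \<Rightarrow> bool" where
  "committed h \<longleftrightarrow> free h \<and> \<not> exploring h"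

text \<open>The budget is exhausted and the enumeration of \<open>anchored T\<close> is bijective,
  so A owns exactly one completed block of \<open>reps\<close> rounds.\<close>

lemma pulls_committed:
  assumes "committed h" "A \<in> anchored T"
  shows "pulls h A = reps"
proof -
  have bij: "bij_betw (from_nat_into (anchored T)) {..<card (anchored T)} (anchored T)"
    by (rule bij_betw_from_nat_into_finite[OF finite_anchored[OF T_ge_1]])
  obtain j where j: "j < card (anchored T)" "from_nat_into (anchored T) j = A"
    using bij assms(2) unfolding bij_betw_def by (metis imageE lessThan_iff)
  have "min (rounds h) budget = card (anchored T) * reps"
    using assms(1) by (auto simp: committed_def exploring_def budget_def)
  moreover have "from_nat_into (anchored T) i = A \<longleftrightarrow> i = j" if "i < card (anchored T)" for i
    using bij j that by (auto simp: bij_betw_def inj_on_def)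
  then have "from_nat_into (anchored T) (k div reps) = A \<longleftrightarrow> k div reps = j"
    if "k < card (anchored T) * reps" for k
    using that by (simp add: div_less_iff_less_mult reps_pos)
  ultimately have "{k. k < min (rounds h) budget \<and> from_nat_into (anchored T) (k div reps) = A} =
      {k. k < card (anchored T) * reps \<and> k div reps = j}"
    by (intro Collect_cong) (metis (no_types, lifting))
  also have "\<dots> = {j * reps..<Suc j * reps}"
  proof -
    have "k div reps = j \<longleftrightarrow> k \<in> {j * reps..<Suc j * reps}" for k
    proof -
      have "k div reps = j \<longleftrightarrow> j \<le> k div reps \<and> k div reps < Suc j"
        by linarith
      then show ?thesis
        by (simp only: atLeastLessThan_iff less_eq_div_iff_mult_less_eq[OF reps_pos]
            div_less_iff_less_mult[OF reps_pos])
    qed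
    moreover have "k < card (anchored T) * reps" if "k < Suc j * reps" for k
      using that j(1) mult_le_mono1[of "Suc j" "card (anchored T)" reps] by linarith
    ultimately show ?thesis
      unfolding set_eq_iff mem_Collect_eq by (metis atLeastLessThan_iff)
  qed
  finally show ?thesis by (simp add: pulls_eq_card)
qed

end

section \<open>Deviations of the empirical coverage under i.i.d. points\<close>

locale stochastic_dual_bandit = dual_bandit +
  fixes D :: "real measure"
  assumes unit_D: "unit_distribution D"
begin

sublocale bandit_run D policy T
proof -
  interpret prob_space D using unit_D by (simp add: unit_distribution_def)
  show "bandit_run D policy"
    using unit_D by unfold_locales (auto simp: unit_distribution_def policy_borel)
qed

text \<open>A martingale along the run: it moves only when A is probed, and then by the centred
  bit.\<close>

definition dev :: "bool list \<Rightarrow> real set \<Rightarrow> real" where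
  "dev h A = real (hits h A) - prob A * real (pulls h A)"

text \<open>An exponential supermartingale. A probe of A multiplies it in conditional mean by a
  centred Bernoulli moment generating function times exp (-s^2), at most 1; other steps leave it
  unchanged.\<close>

lemma expect_exp_dev:
  assumes s: "\<bar>s\<bar> \<le> 1" and "t \<le> T"
  shows "expect (\<lambda>h. exp (s * dev h A - s\<^sup>2 * real (pulls h A))) t \<le> 1"
  using \<open>t \<le> T\<close>
proof (induction t)
  case 0
  show ?case by (simp add: expect_0 dev_def)
next
  case (Suc t)
  let ?F = "\<lambda>h. exp (s * dev h A - s\<^sup>2 * real (pulls h A))"
  have "prob (policy h) * ?F (h @ [True]) + (1 - prob (policy h)) * ?F (h @ [False]) \<le> ?F h" for h
  proof (cases "exploring h \<and> probe h = A")
    case True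
    then have pA: "policy h = A" by (simp add: policy_exploring)
    have T: "?F (h @ [True]) = ?F h * exp (- s\<^sup>2) * exp (s * (1 - prob A))"
      using True unfolding exp_add[symmetric]
      by (intro arg_cong[of _ _ exp]) (simp add: dev_def hits_snoc pulls_snoc algebra_simps)
    have F: "?F (h @ [False]) = ?F h * exp (- s\<^sup>2) * exp (- (s * prob A))"
      using True unfolding exp_add[symmetric]
      by (intro arg_cong[of _ _ exp]) (simp add: dev_def hits_snoc pulls_snoc algebra_simps)
    have "prob (policy h) * ?F (h @ [True]) + (1 - prob (policy h)) * ?F (h @ [False]) =
        ?F h * exp (- s\<^sup>2) * (prob A * exp (s * (1 - prob A)) + (1 - prob A) * exp (- (s * prob A)))"
      unfolding T F pA by (simp add: algebra_simps)
    also have "\<dots> \<le> ?F h * exp (- s\<^sup>2) * exp (s\<^sup>2)"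
      using s by (intro mult_left_mono bernoulli_mgf_le) auto
    also have "\<dots> = ?F h" by (simp add: mult.assoc flip: exp_add)
    finally show ?thesis .
  next
    case False
    then have "hits (h @ [b]) A = hits h A" "pulls (h @ [b]) A = pulls h A" for b
      by (auto simp: hits_snoc pulls_snoc)
    then show ?thesis by (simp add: dev_def algebra_simps)
  qed
  then have "expect ?F (Suc t) \<le> expect ?F t"
    using Suc.prems by (subst expect_Suc) (auto intro!: expect_mono)
  then show ?case using Suc by simp
qed

text \<open>A random envelope for all the deviations at once. The sum over \<open>anchored T\<close>
  takes the place of a union bound, and only its expectation has to be controlled.\<close>

definition width :: "real \<Rightarrow> real \<Rightarrow> bool list \<Rightarrow> real" where
  "width s r h = r + (\<Sum>A\<in>anchored T. (exp (s * (dev h A - r)) + exp (s * (- dev h A - r))) / s)"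

lemma abs_dev_le_width:
  assumes "0 < s" "A \<in> anchored T"
  shows "\<bar>dev h A\<bar> \<le> width s r h"
proof -
  have "(exp (s * (dev h A - r)) + exp (s * (- dev h A - r))) / s \<le>
      (\<Sum>A\<in>anchored T. (exp (s * (dev h A - r)) + exp (s * (- dev h A - r))) / s)"
    using assms finite_anchored[OF T_ge_1] by (intro member_le_sum) auto
  then show ?thesis
    unfolding width_def using abs_le_threshold_plus_exp[OF assms(1), of "dev h A" r] by linarith
qed

text \<open>On committed histories \<open>pulls\<close> equals \<open>reps\<close>, so the
  exponentials in \<open>width\<close> are fixed multiples of the supermartingales with parameters s
  and -s. On all others the left-hand integrand vanishes.\<close>

lemma expect_width:
  assumes s: "0 < s" "s \<le> 1" and r: "0 \<le> r" and t: "t \<le> T"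
  shows "expect (\<lambda>h. of_bool (committed h) * width s r h) t \<le>
    r + real (card (anchored T)) * (2 * exp (s\<^sup>2 * real reps - s * r) / s)"
proof -
  let ?c = "exp (s\<^sup>2 * real reps - s * r) / s"
  let ?E = "\<lambda>s A h. exp (s * dev h A - s\<^sup>2 * real (pulls h A))"
  have "of_bool (committed h) * width s r h \<le>
      r + (\<Sum>A\<in>anchored T. ?c * ?E s A h + ?c * ?E (- s) A h)" (is "_ \<le> ?R") for h
  proof (cases "committed h")
    case True
    have "(exp (s * (dev h A - r)) + exp (s * (- dev h A - r))) / s = ?c * ?E s A h + ?c * ?E (- s) A h"
      if "A \<in> anchored T" for A
      using pulls_committed[OF True that]
      by (simp add: add_divide_distrib algebra_simps flip: exp_add)
    then show ?thesis using True by (simp add: width_def)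
  next
    case False
    then show ?thesis using r s by (simp add: sum_nonneg)
  qed
  then have "expect (\<lambda>h. of_bool (committed h) * width s r h) t \<le>
      expect (\<lambda>h. r + (\<Sum>A\<in>anchored T. ?c * ?E s A h + ?c * ?E (- s) A h)) t"
    using t by (intro expect_mono) auto
  also have "\<dots> = r + (\<Sum>A\<in>anchored T. ?c * expect (?E s A) t + ?c * expect (?E (- s) A) t)"
    using t by (simp only: expect_add expect_sum expect_cmult expect_const)
  also have "\<dots> \<le> r + (\<Sum>A\<in>anchored T. ?c * 1 + ?c * 1)"
    using s t by (intro add_left_mono sum_mono add_mono mult_left_mono expect_exp_dev) auto
  also have "\<dots> = r + real (card (anchored T)) * (2 * ?c)" by simp
  finally show ?thesis by simp
qed

end

section \<open>Regret\<close>

context stochastic_dual_bandit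
begin

abbreviation "Cstar \<equiv> optimal_cost D \<phi>"

lemma Icc_in_borel_D [simp]: "{a..b::real} \<in> events"
  by (simp add: sets_D)

text \<open>Inclusion-exclusion: [0,b] and [a,1] meet in [a,b] and together fill [0,1], which has
  mass 1. Coverage is thus additive in the two endpoints.\<close>

lemma prob_Icc_split:
  assumes "0 \<le> a" "a \<le> b" "b \<le> 1"
  shows "prob {a..b} = prob {0..b} + prob {a..1} - 1"
proof -
  have un: "{0..b} \<union> {a..1} = {0..1}" and int: "{0..b} \<inter> {a..1} = {a..b}"
    using assms by auto
  have "prob ({0..b} \<union> {a..1}) = prob {0..b} + prob {a..1} - prob ({0..b} \<inter> {a..1})"
    by (intro measure_Un3) (auto simp: fmeasurable_eq_sets)
  moreover have "prob {0..1} = 1" using unit_D by (simp add: unit_distribution_def)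
  ultimately show ?thesis unfolding un int by linarith
qed

lemma width_nonneg: "0 < s \<Longrightarrow> 0 \<le> width s r h"
  using abs_dev_le_width[of s _ h r] anchored_nonempty abs_ge_zero order_trans by blast

text \<open>The error is a sum of two deviations, one for each endpoint, divided by the sample size
  \<open>reps\<close>.\<close>

lemma est_error:
  assumes h: "committed h" and s: "0 < s" and I: "I \<in> grid_intervals T"
  shows "\<bar>est h I - prob I\<bar> \<le> 2 * width s r h / reps"
  using I
proof (cases rule: grid_intervals_cases)
  case 1
  then show ?thesis using width_nonneg[OF s] by (simp add: est_def)
next
  case (2 a b)
  have ab: "0 \<le> a" "b \<le> 1" using 2 grid_points_unit[of T] by auto
  have anch: "{0..b} \<in> anchored T" "{a..1} \<in> anchored T"
    using 2 by (auto simp: anchored_def)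
  have hits: "real (hits h A) / reps = dev h A / reps + prob A" if "A \<in> anchored T" for A
    using pulls_committed[OF h that] reps_pos by (simp add: dev_def field_simps)
  have "est h I = real (hits h {0..b}) / reps + real (hits h {a..1}) / reps - 1"
    using 2 by (simp add: est_def)
  also have "\<dots> = (dev h {0..b} + dev h {a..1}) / reps + (prob {0..b} + prob {a..1} - 1)"
    unfolding hits[OF anch(1)] hits[OF anch(2)] by (simp add: add_divide_distrib)
  also have "prob {0..b} + prob {a..1} - 1 = prob I"
    using prob_Icc_split[OF ab(1) 2(3) ab(2)] 2(4) by simp
  finally have "\<bar>est h I - prob I\<bar> = \<bar>dev h {0..b} + dev h {a..1}\<bar> / reps"
    by (simp add: abs_divide)
  also have "\<dots> \<le> 2 * width s r h / reps"
    using abs_dev_le_width[OF s anch(1), of h r] abs_dev_le_width[OF s anch(2), of h r]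
    by (intro divide_right_mono) linarith+
  finally show ?thesis .
qed

text \<open>Weak duality with multiplier \<open>lam h\<close>: the chosen interval minimizes the
  Lagrangian over all J up to rounding and estimation. The estimation error enters at the choice and
  at the comparator, each time with the factor 2 of \<open>est_error\<close>, hence 4.\<close>

lemma committed_regret:
  assumes h: "committed h" and s: "0 < s"
  shows "measure lborel (policy h) - Cstar \<le>
    lam h * (prob (policy h) - \<phi>) + 2 * mesh T + 4 * \<Lambda> / reps * width s r h"
proof -
  let ?e = "2 * width s r h / reps"
  let ?f = "\<lambda>I. measure lborel I - lam h * est h I"
  have lam: "0 \<le> lam h" "lam h \<le> \<Lambda>" using h by (auto simp: committed_def free_def)
  have err: "\<bar>lam h * est h I - lam h * prob I\<bar> \<le> lam h * ?e" if "I \<in> grid_intervals T" for I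
    using mult_left_mono[OF est_error[OF h s that, of r] lam(1)] lam(1)
    by (simp add: abs_mult flip: right_diff_distrib)
  have "measure lborel (policy h) - lam h * (prob (policy h) - \<phi>) - 2 * mesh T - 2 * (lam h * ?e) \<le> Cstar"
  proof (rule optimal_cost_ge[OF unit_D _ lam(1)])
    fix J assume J: "is_interval J" "J \<subseteq> {0..1::real}"
    obtain I where I: "I \<in> grid_intervals T" "J \<subseteq> I"
      "measure lborel I \<le> measure lborel J + 2 * mesh T"
      using grid_outer_approximation[OF T_ge_1 J] by blast
    have "?f (policy h) \<le> ?f I"
      using h finite_grid_intervals[OF T_ge_1] I(1)
      unfolding policy_committed[OF h[unfolded committed_def, THEN conjunct1] h[unfolded committed_def, THEN conjunct2]]
      by (intro arg_min_least[of _ _ ?f]) auto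
    \<comment> \<open>Enlarging J to I can only raise its coverage, which lowers the Lagrangian
      because the multiplier is nonnegative.\<close>
    moreover have "lam h * prob J \<le> lam h * prob I"
      using I lam by (intro mult_left_mono finite_measure_mono) (auto simp: sets_D grid_interval_borel)
    ultimately show "measure lborel (policy h) - lam h * (prob (policy h) - \<phi>) - 2 * mesh T - 2 * (lam h * ?e)
        \<le> measure lborel J - lam h * (prob J - \<phi>)"
      using err[OF I(1)] err[OF policy_in_grid[of h]] I(3) by (simp add: right_diff_distrib abs_le_iff)
  qed (use \<phi>_less_1 in simp)
  moreover have "2 * (lam h * ?e) \<le> 2 * (\<Lambda> * ?e)"
    using lam width_nonneg[OF s] by (intro mult_left_mono mult_right_mono) auto
  moreover have "2 * (\<Lambda> * ?e) = 4 * \<Lambda> / reps * width s r h" by simp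
  ultimately show ?thesis by linarith
qed

text \<open>Forced moves are paid for by the slack term alone. An exploring step loses at most 1 in
  length and at most \<Lambda> through negative slack.\<close>

lemma step_regret:
  assumes s: "0 < s"
  shows "measure lborel (policy h) - Cstar \<le>
    lam h * (prob (policy h) - \<phi>) + 2 * mesh T + (1 + \<Lambda>) * of_bool (exploring h)
      + 4 * \<Lambda> / reps * (of_bool (committed h) * width s r h)"
proof -
  have C: "0 \<le> Cstar" using optimal_cost_nonneg[OF unit_D] \<phi>_less_1 by simp
  have m: "0 < mesh T" by (rule mesh_pos[OF T_ge_1])
  consider "lam h < 0" | "\<Lambda> < lam h" | "exploring h" | "committed h"
    unfolding committed_def free_def by linarith
  then show ?thesis
  proof cases
    case 1
    then have "0 \<le> lam h * (0 - \<phi>)" using \<phi>_pos by (simp add: mult_nonpos_nonneg)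
    then show ?thesis
      using 1 C m by (simp add: policy_low exploring_def committed_def free_def)
  next
    case 2
    \<comment> \<open>This fixes the value of \<Lambda>: above it, the slack of full coverage is at
      least the cost 1 of [0,1].\<close>
    have "1 = \<Lambda> * (1 - \<phi>)" using \<phi>_less_1 by (simp add: \<Lambda>_def)
    also have "\<dots> \<le> lam h * (1 - \<phi>)" using 2 \<phi>_less_1 by (intro mult_right_mono) auto
    finally show ?thesis
      using 2 C m unit_D
      by (simp add: policy_high exploring_def committed_def free_def unit_distribution_def)
  next
    case 3
    then have lam: "0 \<le> lam h" "lam h \<le> \<Lambda>" by (auto simp: exploring_def free_def)
    have "measure lborel (policy h) \<le> 1"
      by (rule measure_lborel_unit_le_one[OF policy_unit])
    moreover have "- \<Lambda> \<le> lam h * (prob (policy h) - \<phi>)"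
    proof -
      have "lam h * \<phi> \<le> \<Lambda> * 1" using lam \<phi>_pos \<phi>_less_1 by (intro mult_mono) auto
      moreover have "0 \<le> lam h * prob (policy h)" using lam by simp
      ultimately show ?thesis by (simp add: right_diff_distrib)
    qed
    ultimately show ?thesis using 3 C m by (simp add: committed_def)
  next
    case 4
    then show ?thesis
      using committed_regret[OF 4 s, of r] by (simp add: committed_def)
  qed
qed

text \<open>Drift of the potential lam^2 / (2 \<eta>): the cross term of the squared update is minus
  the slack, and the second-order term is at most \<eta> / 2 as the increments \<phi> - bit lie in
  [-1,1].\<close>

lemma expect_lam_slack:
  assumes "t < T"
  shows "expect (\<lambda>h. lam h * (prob (policy h) - \<phi>)) t \<le>
    expect (\<lambda>h. (lam h)\<^sup>2 / (2 * \<eta>)) t - expect (\<lambda>h. (lam h)\<^sup>2 / (2 * \<eta>)) (Suc t) + \<eta> / 2"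
proof -
  let ?L = "\<lambda>h. (lam h)\<^sup>2 / (2 * \<eta>)"
  have sq: "(a + \<eta> * d)\<^sup>2 / (2 * \<eta>) = a\<^sup>2 / (2 * \<eta>) + a * d + \<eta> / 2 * d\<^sup>2" for a d
  proof -
    have "(a + \<eta> * d)\<^sup>2 = a\<^sup>2 + 2 * \<eta> * (a * d + \<eta> / 2 * d\<^sup>2)"
      by (simp add: algebra_simps power2_eq_square)
    then show ?thesis using \<eta>_pos by (simp add: add_divide_distrib)
  qed
  have "prob (policy h) * ?L (h @ [True]) + (1 - prob (policy h)) * ?L (h @ [False]) \<le>
      ?L h - lam h * (prob (policy h) - \<phi>) + \<eta> / 2" for h
  proof -
    let ?q = "prob (policy h)"
    have mix: "q * (l + a * (\<phi> - 1) + e * u) + (1 - q) * (l + a * \<phi> + e * v) =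
        l - a * (q - \<phi>) + e * (q * u + (1 - q) * v)" for q l a e u v :: real
      by (simp add: algebra_simps)
    have "?q * ?L (h @ [True]) + (1 - ?q) * ?L (h @ [False]) =
        ?L h - lam h * (?q - \<phi>) + \<eta> / 2 * (?q * (\<phi> - 1)\<^sup>2 + (1 - ?q) * \<phi>\<^sup>2)"
      unfolding lam_snoc sq by (simp only: of_bool_eq diff_zero mix)
    moreover have "\<eta> / 2 * (?q * (\<phi> - 1)\<^sup>2 + (1 - ?q) * \<phi>\<^sup>2) \<le> \<eta> / 2 * (?q * 1 + (1 - ?q) * 1)"
      using \<phi>_pos \<phi>_less_1 \<eta>_pos
      by (intro mult_left_mono add_mono) (auto simp: abs_square_le_1)
    ultimately show ?thesis by simp
  qed
  then have "expect ?L (Suc t) \<le> expect (\<lambda>h. ?L h - lam h * (prob (policy h) - \<phi>) + \<eta> / 2) t"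
    unfolding expect_Suc[OF assms] using assms by (intro expect_mono) auto
  also have "\<dots> = expect ?L t - expect (\<lambda>h. lam h * (prob (policy h) - \<phi>)) t + \<eta> / 2"
    using assms by (simp add: expect_add expect_diff expect_const)
  finally show ?thesis by simp
qed

text \<open>The drift telescopes; the potential starts at 0 and ends nonnegative.\<close>

lemma sum_expect_lam_slack:
  "(\<Sum>t<T. expect (\<lambda>h. lam h * (prob (policy h) - \<phi>)) t) \<le> real T * \<eta> / 2"
proof -
  let ?L = "\<lambda>t. expect (\<lambda>h. (lam h)\<^sup>2 / (2 * \<eta>)) t"
  have "(\<Sum>t<n. expect (\<lambda>h. lam h * (prob (policy h) - \<phi>)) t) \<le> ?L 0 - ?L n + real n * \<eta> / 2" if "n \<le> T" for n
    using that
  proof (induction n)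
    case (Suc n)
    then show ?case using expect_lam_slack[of n] by (simp add: field_simps)
  qed simp
  moreover have "0 \<le> ?L T"
    unfolding expect_def using \<eta>_pos by simp
  ultimately show ?thesis by (fastforce simp: expect_0)
qed

text \<open>All histories are prefixes of the one of length T, so the sum is a single expectation of
  a pathwise bounded count.\<close>

lemma sum_expect_exploring: "(\<Sum>t<T. expect (\<lambda>h. of_bool (exploring h)) t) \<le> real budget"
proof -
  have "expect (\<lambda>h. \<Sum>t<T. of_bool (exploring (take t h))) T = (\<Sum>t<T. expect (\<lambda>h. of_bool (exploring (take t h))) T)"
    by (rule expect_sum) simp
  also have "\<dots> = (\<Sum>t<T. expect (\<lambda>h. of_bool (exploring h)) t)"
    by (rule sum.cong) (simp_all add: expect_def take_feedback)
  finally have "(\<Sum>t<T. expect (\<lambda>h. of_bool (exploring h)) t) =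
      expect (\<lambda>h. \<Sum>t<T. of_bool (exploring (take t h))) T" ..
  also have "\<dots> \<le> expect (\<lambda>h. real budget) T"
  proof (rule expect_mono)
    fix h :: "bool list" assume h: "length h = T"
    show "(\<Sum>t<T. of_bool (exploring (take t h))) \<le> real budget"
      using of_nat_mono[OF exploring_steps_le[of h]] by (simp add: h)
  qed simp
  also have "\<dots> = real budget" by (simp add: expect_const)
  finally show ?thesis .
qed

text \<open>The four terms come from dual drift, rounding, probing and estimation. The parameters s
  and r are chosen in \<open>regret_bound\<close>.\<close>

lemma regret_decomposition:
  assumes s: "0 < s" "s \<le> 1" and r: "0 \<le> r"
  shows "(\<Sum>t<T. expect (\<lambda>h. measure lborel (policy h) - Cstar) t) \<le>
    real T * \<eta> / 2 + 2 * real T * mesh T + (1 + \<Lambda>) * real budget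
    + 4 * \<Lambda> / reps * (real T * (r + real (card (anchored T)) * (2 * exp (s\<^sup>2 * real reps - s * r) / s)))"
    (is "_ \<le> _ + 4 * \<Lambda> / reps * (real T * ?W)")
proof -
  have "expect (\<lambda>h. measure lborel (policy h) - Cstar) t \<le>
      expect (\<lambda>h. lam h * (prob (policy h) - \<phi>)) t + 2 * mesh T
      + (1 + \<Lambda>) * expect (\<lambda>h. of_bool (exploring h)) t + 4 * \<Lambda> / reps * ?W" if "t < T" for t
  proof -
    have "expect (\<lambda>h. measure lborel (policy h) - Cstar) t \<le>
        expect (\<lambda>h. lam h * (prob (policy h) - \<phi>) + 2 * mesh T + (1 + \<Lambda>) * of_bool (exploring h)
          + 4 * \<Lambda> / reps * (of_bool (committed h) * width s r h)) t"
      using that by (intro expect_mono step_regret s) auto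
    also have "\<dots> = expect (\<lambda>h. lam h * (prob (policy h) - \<phi>)) t + 2 * mesh T
        + (1 + \<Lambda>) * expect (\<lambda>h. of_bool (exploring h)) t
        + 4 * \<Lambda> / reps * expect (\<lambda>h. of_bool (committed h) * width s r h) t"
      using that by (simp only: expect_add expect_cmult expect_const less_imp_le)
    also have "\<dots> \<le> expect (\<lambda>h. lam h * (prob (policy h) - \<phi>)) t + 2 * mesh T
        + (1 + \<Lambda>) * expect (\<lambda>h. of_bool (exploring h)) t + 4 * \<Lambda> / reps * ?W"
      using that \<Lambda>_ge_1 by (intro add_left_mono mult_left_mono expect_width s r) auto
    finally show ?thesis .
  qed
  then have "(\<Sum>t<T. expect (\<lambda>h. measure lborel (policy h) - Cstar) t) \<le>
      (\<Sum>t<T. expect (\<lambda>h. lam h * (prob (policy h) - \<phi>)) t + 2 * mesh T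
      + (1 + \<Lambda>) * expect (\<lambda>h. of_bool (exploring h)) t + 4 * \<Lambda> / reps * ?W)"
    by (intro sum_mono) auto
  also have "\<dots> = (\<Sum>t<T. expect (\<lambda>h. lam h * (prob (policy h) - \<phi>)) t) + 2 * real T * mesh T
      + (1 + \<Lambda>) * (\<Sum>t<T. expect (\<lambda>h. of_bool (exploring h)) t) + 4 * \<Lambda> / reps * (real T * ?W)"
    by (simp add: sum.distrib sum_distrib_left)
  also have "\<dots> \<le> real T * \<eta> / 2 + 2 * real T * mesh T + (1 + \<Lambda>) * real budget + 4 * \<Lambda> / reps * (real T * ?W)"
    using \<Lambda>_ge_1 by (intro add_mono mult_left_mono sum_expect_lam_slack sum_expect_exploring order_refl) auto
  finally show ?thesis .
qed

end

text \<open>The second marginal of the product is N; this integrates out the internal randomness,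
  which a deterministic policy ignores.\<close>

lemma integral_pair_snd:
  fixes g :: "'b \<Rightarrow> real"
  assumes "prob_space M" "sigma_finite_measure N" and g: "g \<in> borel_measurable N"
  shows "(\<integral>z. g (snd z) \<partial>(M \<Otimes>\<^sub>M N)) = integral\<^sup>L N g"
proof -
  interpret M: prob_space M by fact
  interpret N: sigma_finite_measure N by fact
  have "distr (M \<Otimes>\<^sub>M N) N snd = N"
  proof (rule measure_eqI)
    fix A assume "A \<in> sets (distr (M \<Otimes>\<^sub>M N) N snd)"
    then have A: "A \<in> sets N" by simp
    have "snd -` A \<inter> space (M \<Otimes>\<^sub>M N) = space M \<times> A"
      using sets.sets_into_space[OF A] by (auto simp: space_pair_measure)
    then show "emeasure (distr (M \<Otimes>\<^sub>M N) N snd) A = emeasure N A"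
      using A by (simp add: emeasure_distr N.emeasure_pair_measure_Times M.emeasure_space_1)
  qed simp
  then show ?thesis
    using integral_distr[OF measurable_snd g, of M] by simp
qed

section \<open>Lower bound on the regret, and the final rate\<close>

context stochastic_dual_bandit
begin

text \<open>D lives on all reals with mass 1 on [0,1], so pathwise bounds carry over only almost
  surely.\<close>

lemma AE_points_unit: "AE y in points. \<forall>t\<in>{1..T}. y t \<in> {0..1}"
proof (rule AE_finite_allI)
  fix t assume "t \<in> {1..T}"
  moreover have "AE x in D. x \<in> {0..1}"
    using unit_D by (intro AE_in_set_eq_1[THEN iffD2]) (auto simp: unit_distribution_def)
  ultimately show "AE y in points. y t \<in> {0..1}"
    by (intro AE_PiM_component prob_space_axioms)
qed simp

lemma expect_lam_le: "expect lam T \<le> \<Lambda> + \<eta>"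
proof -
  interpret H: prob_space points by (rule prob_space_history)
  have "AE y in points. lam (feedback policy y T) \<le> \<Lambda> + \<eta>"
    using AE_points_unit by eventually_elim (use lam_feedback_bounds in blast)
  then have "expect lam T \<le> (\<integral>y. \<Lambda> + \<eta> \<partial>points)"
    unfolding expect_def by (intro integral_mono_AE integrable_feedback) auto
  also have "\<dots> = \<Lambda> + \<eta>"
    by (simp add: prob_space.prob_space[OF prob_space_history])
  finally show ?thesis .
qed

text \<open>The expected multiplier is the accumulated coverage deficit times \<eta>, so its upper
  bound turns into a lower bound on coverage.\<close>

lemma expect_lam: "t \<le> T \<Longrightarrow> expect lam t = \<eta> * (\<Sum>s<t. \<phi> - expect (\<lambda>h. prob (policy h)) s)"
proof (induction t)
  case (Suc t)
  have "expect lam (Suc t) = expect (\<lambda>h. lam h + \<eta> * (\<phi> - prob (policy h))) t"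
    using Suc.prems by (subst expect_Suc) (simp_all add: algebra_simps)
  also have "\<dots> = expect lam t + \<eta> * (\<phi> - expect (\<lambda>h. prob (policy h)) t)"
    using Suc.prems by (simp add: expect_add expect_cmult expect_diff expect_const)
  finally show ?case using Suc by (simp add: algebra_simps)
qed (simp add: expect_0)

lemma sum_expect_coverage:
  "real T * \<phi> - (\<Lambda> + \<eta>) / \<eta> \<le> (\<Sum>t<T. expect (\<lambda>h. prob (policy h)) t)"
proof -
  have "real T * \<phi> - (\<Sum>t<T. expect (\<lambda>h. prob (policy h)) t) \<le> (\<Lambda> + \<eta>) / \<eta>"
    using expect_lam_le \<eta>_pos by (simp add: expect_lam sum_subtractf pos_le_divide_eq mult.commute)
  then show ?thesis by linarith
qed

text \<open>The law of the interval played at a uniformly random step.\<close>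

definition mean_law :: "real set \<Rightarrow> real" where
  "mean_law I = (\<Sum>t<T. expect (\<lambda>h. of_bool (policy h = I)) t) / real T"

lemma sum_mean_law:
  "(\<Sum>I\<in>grid_intervals T. mean_law I * f I) = (\<Sum>t<T. expect (\<lambda>h. f (policy h)) t) / real T"
proof -
  have f: "f (policy h) = (\<Sum>I\<in>grid_intervals T. f I * of_bool (policy h = I))" for h
    using finite_grid_intervals[OF T_ge_1] policy_in_grid[of h]
    by (simp add: of_bool_def if_distrib cong: if_cong)
  have "(\<Sum>t<T. expect (\<lambda>h. f (policy h)) t) =
      (\<Sum>t<T. \<Sum>I\<in>grid_intervals T. f I * expect (\<lambda>h. of_bool (policy h = I)) t)"
    unfolding f by (intro sum.cong refl) (simp add: expect_sum expect_cmult)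
  also have "\<dots> = (\<Sum>I\<in>grid_intervals T. \<Sum>t<T. f I * expect (\<lambda>h. of_bool (policy h = I)) t)"
    by (rule sum.swap)
  finally show ?thesis
    by (simp add: mean_law_def sum_divide_distrib sum_distrib_left mult.commute)
qed

text \<open>The mean law misses coverage \<phi> by at most \<epsilon>. Shifting weight \<theta> to
  [0,1] repairs this and adds at most \<theta> to the cost, so the policy cannot be much cheaper
  than the benchmark.\<close>

lemma regret_lower:
  "- (\<Lambda> * ((\<Lambda> + \<eta>) / \<eta>)) \<le> (\<Sum>t<T. expect (\<lambda>h. measure lborel (policy h) - Cstar) t)"
proof -
  let ?G = "grid_intervals T"
  define \<epsilon> where "\<epsilon> = (\<Lambda> + \<eta>) / \<eta> / real T"
  \<comment> \<open>\<Lambda> * \<epsilon> solves \<theta> (1 - \<phi>) = \<epsilon>, which offsets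
    the deficit; the cap keeps \<theta> a probability.\<close>
  define \<theta> where "\<theta> = min 1 (\<Lambda> * \<epsilon>)"
  define w where "w I = (1 - \<theta>) * mean_law I + \<theta> * of_bool (I = {0..1})" for I :: "real set"
  define c where "c = (\<Sum>t<T. expect (\<lambda>h. measure lborel (policy h)) t) / real T"
  define v where "v = (\<Sum>t<T. expect (\<lambda>h. prob (policy h)) t) / real T"
  have T: "0 < real T" using T_ge_2 by simp
  have \<epsilon>: "0 \<le> \<epsilon>" using \<Lambda>_ge_1 \<eta>_pos by (simp add: \<epsilon>_def)
  have \<theta>: "0 \<le> \<theta>" "\<theta> \<le> 1" using \<epsilon> \<Lambda>_ge_1 by (auto simp: \<theta>_def)
  have full: "{0..1} \<in> ?G" by (intro Icc_in_grid zero_one_grid) simp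
  have wsum: "(\<Sum>I\<in>?G. w I * f I) = (1 - \<theta>) * ((\<Sum>t<T. expect (\<lambda>h. f (policy h)) t) / real T) + \<theta> * f {0..1}" for f
  proof -
    have "(\<Sum>I\<in>?G. w I * f I) = (1 - \<theta>) * (\<Sum>I\<in>?G. mean_law I * f I)
        + \<theta> * (\<Sum>I\<in>?G. of_bool (I = {0..1}) * f I)"
      by (simp add: w_def sum.distrib sum_distrib_left distrib_right mult.assoc)
    also have "(\<Sum>I\<in>?G. of_bool (I = {0..1}) * f I) = f {0..1}"
      using full finite_grid_intervals[OF T_ge_1] by (simp add: of_bool_def if_distrib if_distribR cong: if_cong)
    finally show ?thesis unfolding sum_mean_law .
  qed
  have v: "\<phi> - \<epsilon> \<le> v"
    using divide_right_mono[OF sum_expect_coverage, of "real T"] T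
    by (simp add: v_def \<epsilon>_def diff_divide_distrib)
  have cov: "\<phi> \<le> (1 - \<theta>) * v + \<theta>"
  proof (cases "\<Lambda> * \<epsilon> \<le> 1")
    case True
    then have \<theta>_eq: "\<theta> * (1 - \<phi>) = \<epsilon>" using \<phi>_less_1 by (simp add: \<theta>_def \<Lambda>_def)
    have "\<phi> \<le> \<phi> + \<theta> * \<epsilon>" using \<theta> \<epsilon> by simp
    also have "\<dots> = (1 - \<theta>) * (\<phi> - \<epsilon>) + \<theta>" using \<theta>_eq by (simp add: algebra_simps)
    also have "\<dots> \<le> (1 - \<theta>) * v + \<theta>" using v \<theta> by (intro add_right_mono mult_left_mono) auto
    finally show ?thesis .
  next
    case False
    then have "\<theta> = 1" by (simp add: \<theta>_def)
    then show ?thesis using \<phi>_less_1 by simp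
  qed
  have "Cstar \<le> (\<Sum>I\<in>?G. w I * measure lborel I)"
  proof (rule optimal_cost_le_mixture[OF unit_D finite_grid_intervals[OF T_ge_1]])
    show "0 \<le> w I" for I
      using \<theta> by (simp add: w_def mean_law_def expect_def sum_nonneg)
    show "(\<Sum>I\<in>?G. w I) = 1"
      using wsum[of "\<lambda>_. 1"] T by (simp add: expect_const)
    show "\<phi> \<le> (\<Sum>I\<in>?G. w I * prob I)"
      using cov wsum[of prob] unit_D by (simp add: v_def unit_distribution_def)
  qed (simp_all add: grid_interval_is_interval grid_interval_unit)
  also have "\<dots> = (1 - \<theta>) * c + \<theta>" unfolding wsum by (simp add: c_def)
  also have "\<dots> \<le> c + \<Lambda> * \<epsilon>"
  proof -
    have "0 \<le> c" by (simp add: c_def expect_def sum_nonneg)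
    then have "(1 - \<theta>) * c \<le> c" using \<theta> by (simp add: mult_left_le_one_le)
    then show ?thesis by (simp add: \<theta>_def)
  qed
  finally have "real T * (Cstar - c) \<le> real T * (\<Lambda> * \<epsilon>)"
    using T by (intro mult_left_mono) auto
  moreover have "real T * (\<Lambda> * \<epsilon>) = \<Lambda> * ((\<Lambda> + \<eta>) / \<eta>)" using T by (simp add: \<epsilon>_def)
  moreover have "(\<Sum>t<T. expect (\<lambda>h. measure lborel (policy h) - Cstar) t) = real T * (c - Cstar)"
    using T by (simp add: expect_diff expect_const sum_subtractf c_def right_diff_distrib)
  ultimately show ?thesis by (simp add: right_diff_distrib)
qed

lemma regret_bound:
  "\<bar>\<Sum>t<T. expect (\<lambda>h. measure lborel (policy h) - Cstar) t\<bar>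
    \<le> 400 * \<Lambda>\<^sup>2 * real T powr (3 / 4) * ln (real T)"
proof -
  \<comment> \<open>Everything becomes a power of m: T = 1/m^4, B = 1/m^3 and \<eta> = m^2.\<close>
  define m where "m = mesh T"
  define B where "B = real T powr (3 / 4)"
  have T: "0 < real T" "1 \<le> real T" "2 \<le> real T" using T_ge_2 by auto
  have m: "0 < m" "m \<le> 1" using mesh_pos mesh_le_one T_ge_1 by (auto simp: m_def)
  have B: "B = real T * m"
    using T powr_mult_base[of "real T" "- 1 / 4"] by (simp add: B_def m_def mesh_def)
  have sqT: "sqrt (real T) = 1 / m\<^sup>2"
  proof -
    have "m\<^sup>2 = real T powr - (1 / 2)"
      by (simp add: m_def mesh_def power2_eq_square flip: powr_add)
    also have "\<dots> = 1 / sqrt (real T)"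
      using T by (simp add: powr_minus_divide powr_half_sqrt)
    finally show ?thesis using T by simp
  qed
  \<comment> \<open>Terms without a logarithm are absorbed through 1 \<le> 2 ln T.\<close>
  have ln2: "1 / 2 \<le> ln (real T)"
  proof -
    have "exp (1 / 2) \<le> (2 :: real)" using exp_half_le2 by simp
    then show ?thesis using T by (subst ln_ge_iff) auto
  qed
  have Tm: "real T = 1 / m ^ 4"
    using arg_cong[OF sqT, of "\<lambda>x. x\<^sup>2"] T by (simp add: power_divide)
  have B3: "B = 1 / m ^ 3"
    using m by (simp add: B Tm power4_eq_xxxx power3_eq_cube)
  have "1 / m ^ k \<le> B" if "k \<le> 3" for k
    unfolding B3 using that m by (intro divide_left_mono power_decreasing) auto
  from this[of 1] this[of 2] this[of 0] have inv_le: "1 / m \<le> B" "1 / m\<^sup>2 \<le> B" "1 \<le> B"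
    by simp_all
  have \<eta>: "\<eta> = m\<^sup>2" using sqT by (simp add: \<eta>_def)
  have reps: "1 / m\<^sup>2 \<le> real reps" "real reps \<le> 1 / m\<^sup>2 + 1"
  proof -
    have "real reps = of_int \<lceil>sqrt (real T)\<rceil>" using T by (simp add: reps_def)
    then show "1 / m\<^sup>2 \<le> real reps" "real reps \<le> 1 / m\<^sup>2 + 1"
      unfolding sqT by (simp_all only: le_of_int_ceiling of_int_ceiling_le_add_one)
  qed
  have J: "real (card (anchored T)) \<le> 6 / m"
    using card_anchored[OF T_ge_1] by (simp add: m_def)
  have budget: "real budget \<le> 12 * B"
  proof -
    have "real budget \<le> 6 / m * (1 / m\<^sup>2 + 1)"
      unfolding budget_def of_nat_mult using J reps m by (intro mult_mono) auto
    also have "\<dots> = 6 * B + 6 * (1 / m)"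
      unfolding B3 using m by (simp add: field_simps power2_eq_square power3_eq_cube)
    also have "\<dots> \<le> 12 * B" using inv_le by simp
    finally show ?thesis .
  qed
  \<comment> \<open>With these choices s^2 * \<open>reps\<close> = 1 and s * r = ln T, so the
    exponential factor is e / T, small enough to beat the number of anchored intervals.\<close>
  define s where "s = 1 / sqrt (real reps)"
  define r where "r = sqrt (real reps) * ln (real T)"
  have sq_reps: "1 \<le> sqrt (real reps)" "1 / m \<le> sqrt (real reps)"
  proof -
    show "1 \<le> sqrt (real reps)" using reps_pos by simp
    show "1 / m \<le> sqrt (real reps)"
      using reps(1) by (intro real_le_rsqrt) (simp add: power_divide)
  qed
  have s: "0 < s" "s \<le> 1" and r: "0 \<le> r"
    using sq_reps T by (simp_all add: s_def r_def)
  let ?W = "r + real (card (anchored T)) * (2 * exp (s\<^sup>2 * real reps - s * r) / s)"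
  have W: "?W \<le> sqrt (real reps) * (ln (real T) + 36)"
  proof -
    have "s\<^sup>2 * real reps - s * r = 1 - ln (real T)"
      using reps_pos by (simp add: s_def r_def power_divide)
    then have "exp (s\<^sup>2 * real reps - s * r) \<le> 3 / real T"
      using T exp_le by (simp add: exp_diff divide_right_mono)
    then have "2 * exp (s\<^sup>2 * real reps - s * r) / s \<le> 2 * (3 / real T) / s"
      using s by (intro divide_right_mono mult_left_mono) auto
    then have "real (card (anchored T)) * (2 * exp (s\<^sup>2 * real reps - s * r) / s)
        \<le> 6 / m * (2 * (3 / real T) / s)"
      using J s m by (intro mult_mono) auto
    also have "\<dots> = 36 * sqrt (real reps) * m ^ 3"
      using m by (simp add: s_def Tm eval_nat_numeral)
    also have "\<dots> \<le> 36 * sqrt (real reps) * 1"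
      using m by (intro mult_left_mono power_le_one) auto
    finally show ?thesis by (simp add: r_def algebra_simps)
  qed
  have err: "4 * \<Lambda> / reps * (real T * ?W) \<le> 4 * \<Lambda> * B * (ln (real T) + 36)"
  proof -
    have "4 * \<Lambda> / reps * (real T * ?W) \<le>
        4 * \<Lambda> / reps * (real T * (sqrt (real reps) * (ln (real T) + 36)))"
      using W \<Lambda>_ge_1 by (intro mult_left_mono) auto
    also have "\<dots> = 4 * \<Lambda> * real T * (ln (real T) + 36) * (sqrt (real reps) / real reps)"
      by simp
    also have "sqrt (real reps) / real reps = 1 / sqrt (real reps)"
      using reps_pos by (simp add: real_div_sqrt divide_simps)
    also have "4 * \<Lambda> * real T * (ln (real T) + 36) * (1 / sqrt (real reps)) \<le>
        4 * \<Lambda> * real T * (ln (real T) + 36) * m"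
      using sq_reps m \<Lambda>_ge_1 T ln2 by (intro mult_left_mono) (auto simp: field_simps)
    also have "\<dots> = 4 * \<Lambda> * B * (ln (real T) + 36)" by (simp add: B)
    finally show ?thesis .
  qed
  have up: "(\<Sum>t<T. expect (\<lambda>h. measure lborel (policy h) - Cstar) t) \<le>
      B + 2 * B + (1 + \<Lambda>) * (12 * B) + 4 * \<Lambda> * B * (ln (real T) + 36)"
  proof -
    have "real T * \<eta> / 2 \<le> B"
      using inv_le m by (simp add: \<eta> Tm eval_nat_numeral field_simps)
    moreover have "2 * real T * mesh T = 2 * B" by (simp add: B m_def)
    moreover have "(1 + \<Lambda>) * real budget \<le> (1 + \<Lambda>) * (12 * B)"
      using budget \<Lambda>_ge_1 by (intro mult_left_mono) auto
    ultimately show ?thesis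
      using regret_decomposition[OF s r] err by linarith
  qed
  have "B * 1 \<le> B * (2 * ln (real T))" using inv_le ln2 by (intro mult_left_mono) auto
  then have Bl: "B \<le> 2 * (B * ln (real T))" by simp
  \<comment> \<open>A common majorant: as \<Lambda> \<ge> 1, lower powers of \<Lambda> are bounded
    by its square.\<close>
  define X where "X = \<Lambda>\<^sup>2 * (B * ln (real T))"
  have Lsq: "\<Lambda> \<le> \<Lambda>\<^sup>2" "1 \<le> \<Lambda>\<^sup>2"
    using \<Lambda>_ge_1 one_le_power[of \<Lambda> 2] self_le_power[of \<Lambda> 2] by simp_all
  have Bln: "0 \<le> B * ln (real T)" using inv_le ln2 by simp
  have X: "B * ln (real T) \<le> X" "\<Lambda> * (B * ln (real T)) \<le> X" "\<Lambda> * B \<le> 2 * X" "\<Lambda>\<^sup>2 * B \<le> 2 * X"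
  proof -
    show "B * ln (real T) \<le> X" "\<Lambda> * (B * ln (real T)) \<le> X"
      using mult_right_mono[OF Lsq(2) Bln] mult_right_mono[OF Lsq(1) Bln] by (simp_all add: X_def)
    have "\<Lambda> * B \<le> \<Lambda>\<^sup>2 * B" using Lsq inv_le by (intro mult_right_mono) auto
    moreover show "\<Lambda>\<^sup>2 * B \<le> 2 * X"
      using mult_left_mono[OF Bl, of "\<Lambda>\<^sup>2"] by (simp add: X_def)
    ultimately show "\<Lambda> * B \<le> 2 * X" by simp
  qed
  have "4 * \<Lambda> * B * (ln (real T) + 36) = 4 * (\<Lambda> * (B * ln (real T))) + 144 * (\<Lambda> * B)"
    "(1 + \<Lambda>) * (12 * B) = 12 * B + 12 * (\<Lambda> * B)"
    by (simp_all add: algebra_simps)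
  \<comment> \<open>The terms 15 B + 156 \<Lambda> B + 4 \<Lambda> B ln T amount to at most (30 +
    312 + 4) X.\<close>
  then have "(\<Sum>t<T. expect (\<lambda>h. measure lborel (policy h) - Cstar) t) \<le> 400 * X"
    using up X Bl Bln by linarith
  moreover have "- (400 * X) \<le> (\<Sum>t<T. expect (\<lambda>h. measure lborel (policy h) - Cstar) t)"
  proof -
    have "\<Lambda> * ((\<Lambda> + \<eta>) / \<eta>) = \<Lambda>\<^sup>2 * (1 / m\<^sup>2) + \<Lambda>"
      using m by (simp add: \<eta> add_divide_distrib power2_eq_square distrib_left)
    also have "\<dots> \<le> \<Lambda>\<^sup>2 * B + \<Lambda> * B"
      using inv_le \<Lambda>_ge_1 by (intro add_mono mult_left_mono) auto
    finally show ?thesis using regret_lower X Bln by linarith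
  qed
  ultimately show ?thesis by (simp add: X_def B_def abs_le_iff mult.assoc)
qed

text \<open>Steps are numbered from 1 and histories by length from 0; after this shift the regret is
  a finite sum of history expectations.\<close>

lemma expected_regret:
  assumes "prob_space R"
  shows "(\<integral>(u, y). (\<Sum>t=1..T. measure lborel (chosen policy y t) - Cstar) \<partial>(R \<Otimes>\<^sub>M points)) =
    (\<Sum>t<T. expect (\<lambda>h. measure lborel (policy h) - Cstar) t)"
proof -
  interpret H: prob_space points by (rule prob_space_history)
  let ?g = "\<lambda>y t. measure lborel (policy (feedback policy y t)) - Cstar"
  have int: "integrable points (\<lambda>y. ?g y t)" if "t \<in> {..<T}" for t
    using that by (intro integrable_feedback[where F = "\<lambda>h. measure lborel (policy h) - Cstar"]) auto
  have "(\<Sum>t=1..T. measure lborel (chosen policy y t) - Cstar) = (\<Sum>t<T. ?g y t)" for y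
    by (simp add: chosen_def sum.atLeast1_atMost_eq)
  then have "(\<integral>(u, y). (\<Sum>t=1..T. measure lborel (chosen policy y t) - Cstar) \<partial>(R \<Otimes>\<^sub>M points)) =
      (\<integral>z. (\<Sum>t<T. ?g (snd z) t) \<partial>(R \<Otimes>\<^sub>M points))"
    by (simp only: case_prod_unfold)
  also have "\<dots> = (\<integral>y. (\<Sum>t<T. ?g y t) \<partial>points)"
    by (rule integral_pair_snd[OF assms prob_space_imp_sigma_finite[OF prob_space_history]])
      (intro borel_measurable_sum borel_measurable_integrable int)
  also have "\<dots> = (\<Sum>t<T. expect (\<lambda>h. measure lborel (policy h) - Cstar) t)"
    unfolding expect_def by (rule Bochner_Integration.integral_sum) (rule int)
  finally show ?thesis .
qed

end

lemma constant_random_interval: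
  assumes "prob_space M" "is_interval J" "J \<subseteq> {0..1}"
  shows "random_interval M (\<lambda>_. J)"
proof -
  have "Measurable.pred (M \<Otimes>\<^sub>M borel) (\<lambda>z. snd z \<in> J)"
    by (rule pred_sets2[OF is_interval_borel[OF assms(2)] measurable_snd])
  then show ?thesis using assms by (simp add: random_interval_def)
qed

theorem corollary2:
  shows "(\<forall>T\<ge>2. finite (grid_intervals T)) \<and>
    (\<lambda>T. real (card (grid_intervals T))) \<in> O(\<lambda>T. 1 / (mesh T)\<^sup>2) \<and>
    (\<exists>k::nat. \<forall>\<phi>::real. 0 < \<phi> \<and> \<phi> < 1 \<longrightarrow>
      (\<exists>C::real. \<forall>T::nat. T \<ge> 2 \<longrightarrow>
        (\<exists>R \<pi>.
          bandit_policy R \<pi> \<and>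
          (\<forall>u\<in>space R. \<forall>h. \<pi> u h \<in> grid_intervals T) \<and>
          (let n = card (grid_intervals T); \<Lambda> = 1 / (1 - \<phi>); \<eta> = 1 / sqrt (real T) in
            \<forall>u\<in>space R. \<forall>y \<in> {1..T} \<rightarrow> {0..1}. \<forall>l L::nat.
              L \<ge> 1 \<and> {l..l + L - 1} \<subseteq> {n - 1..T} \<longrightarrow>
              \<bar>1 / real L * (\<Sum>t=l..l + L - 1. covered (\<pi> u) y t) - \<phi>\<bar>
                \<le> (\<Lambda> + 2 * \<eta>) / (\<eta> * real L)) \<and>
          (\<forall>D. unit_distribution D \<longrightarrow>
              \<bar>\<integral>(u, y). (\<Sum>t=1..T. measure lborel (chosen (\<pi> u) y t) - optimal_cost D \<phi>)
                  \<partial>(R \<Otimes>\<^sub>M (\<Pi>\<^sub>M t\<in>{1..T}. D))\<bar>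
                \<le> C * real T powr (3 / 4) * ln (real T) ^ k))))"
proof (intro conjI)
  show "\<forall>T\<ge>2. finite (grid_intervals T)"
    by (simp add: finite_grid_intervals)
  show "(\<lambda>T. real (card (grid_intervals T))) \<in> O(\<lambda>T. 1 / (mesh T)\<^sup>2)"
    by (rule bigoI[of _ 10], rule eventually_mono[OF eventually_ge_at_top[of 1]])
      (use card_grid_intervals in simp)
  show "\<exists>k::nat. \<forall>\<phi>::real. 0 < \<phi> \<and> \<phi> < 1 \<longrightarrow>
      (\<exists>C::real. \<forall>T::nat. T \<ge> 2 \<longrightarrow>
        (\<exists>R \<pi>.
          bandit_policy R \<pi> \<and>
          (\<forall>u\<in>space R. \<forall>h. \<pi> u h \<in> grid_intervals T) \<and>
          (let n = card (grid_intervals T); \<Lambda> = 1 / (1 - \<phi>); \<eta> = 1 / sqrt (real T) in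
            \<forall>u\<in>space R. \<forall>y \<in> {1..T} \<rightarrow> {0..1}. \<forall>l L::nat.
              L \<ge> 1 \<and> {l..l + L - 1} \<subseteq> {n - 1..T} \<longrightarrow>
              \<bar>1 / real L * (\<Sum>t=l..l + L - 1. covered (\<pi> u) y t) - \<phi>\<bar>
                \<le> (\<Lambda> + 2 * \<eta>) / (\<eta> * real L)) \<and>
          (\<forall>D. unit_distribution D \<longrightarrow>
              \<bar>\<integral>(u, y). (\<Sum>t=1..T. measure lborel (chosen (\<pi> u) y t) - optimal_cost D \<phi>)
                  \<partial>(R \<Otimes>\<^sub>M (\<Pi>\<^sub>M t\<in>{1..T}. D))\<bar>
                \<le> C * real T powr (3 / 4) * ln (real T) ^ k)))"
  proof (rule exI[of _ 1], intro allI impI)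
    fix \<phi> :: real
    assume \<phi>: "0 < \<phi> \<and> \<phi> < 1"
    let ?\<Lambda> = "1 / (1 - \<phi>)"
    show "\<exists>C. \<forall>T\<ge>2. \<exists>R \<pi>.
          bandit_policy R \<pi> \<and>
          (\<forall>u\<in>space R. \<forall>h. \<pi> u h \<in> grid_intervals T) \<and>
          (let n = card (grid_intervals T); \<Lambda> = 1 / (1 - \<phi>); \<eta> = 1 / sqrt (real T) in
            \<forall>u\<in>space R. \<forall>y \<in> {1..T} \<rightarrow> {0..1}. \<forall>l L::nat.
              L \<ge> 1 \<and> {l..l + L - 1} \<subseteq> {n - 1..T} \<longrightarrow>
              \<bar>1 / real L * (\<Sum>t=l..l + L - 1. covered (\<pi> u) y t) - \<phi>\<bar>
                \<le> (\<Lambda> + 2 * \<eta>) / (\<eta> * real L)) \<and>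
          (\<forall>D. unit_distribution D \<longrightarrow>
              \<bar>\<integral>(u, y). (\<Sum>t=1..T. measure lborel (chosen (\<pi> u) y t) - optimal_cost D \<phi>)
                  \<partial>(R \<Otimes>\<^sub>M (\<Pi>\<^sub>M t\<in>{1..T}. D))\<bar>
                \<le> C * real T powr (3 / 4) * ln (real T) ^ 1)"
    \<comment> \<open>The constant depends on \<phi> alone, through \<Lambda>; a single logarithm
      suffices.\<close>
    proof (rule exI[of _ "400 * ?\<Lambda>\<^sup>2"], intro allI impI)
      fix T :: nat
      assume T: "T \<ge> 2"
      interpret dual_bandit T \<phi> using T \<phi> by unfold_locales auto
      \<comment> \<open>A point mass, as the policy is deterministic.\<close>
      define R :: "real measure" where "R = return borel 0"
      have R: "prob_space R" by (simp add: R_def prob_space_return)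
      \<comment> \<open>The empty interval and [0,1] give n \<ge> 2, so every admissible window
        starts at step 1 or later.\<close>
      have "2 \<le> card (grid_intervals T)"
        using card_mono[OF finite_grid_intervals[OF T_ge_1], of "{{}, {0..1}}"]
          empty_in_grid Icc_in_grid[OF zero_one_grid] by auto
      then have sub: "{card (grid_intervals T) - 1..T} \<subseteq> {1..T}" by auto
      have "bandit_policy R (\<lambda>_. policy)"
        by (simp add: bandit_policy_def constant_random_interval R policy_is_interval policy_unit)
      moreover have "\<bar>1 / real L * (\<Sum>t=l..l + L - 1. covered policy y t) - \<phi>\<bar>
          \<le> (\<Lambda> + 2 * \<eta>) / (\<eta> * real L)"
        if "y \<in> {1..T} \<rightarrow> {0..1}" "L \<ge> 1 \<and> {l..l + L - 1} \<subseteq> {card (grid_intervals T) - 1..T}" for y l L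
        using that(2) sub by (intro pathwise_validity[OF that(1)]) auto
      moreover have "\<bar>\<integral>(u, y). (\<Sum>t=1..T. measure lborel (chosen policy y t) - optimal_cost D \<phi>)
          \<partial>(R \<Otimes>\<^sub>M (\<Pi>\<^sub>M t\<in>{1..T}. D))\<bar> \<le> 400 * \<Lambda>\<^sup>2 * real T powr (3 / 4) * ln (real T)"
        if "unit_distribution D" for D
      proof -
        interpret stochastic_dual_bandit T \<phi> D using that by unfold_locales
        show ?thesis using regret_bound unfolding expected_regret[OF R] .
      qed
      ultimately show "\<exists>R \<pi>.
          bandit_policy R \<pi> \<and>
          (\<forall>u\<in>space R. \<forall>h. \<pi> u h \<in> grid_intervals T) \<and>
          (let n = card (grid_intervals T); \<Lambda> = 1 / (1 - \<phi>); \<eta> = 1 / sqrt (real T) in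
            \<forall>u\<in>space R. \<forall>y \<in> {1..T} \<rightarrow> {0..1}. \<forall>l L::nat.
              L \<ge> 1 \<and> {l..l + L - 1} \<subseteq> {n - 1..T} \<longrightarrow>
              \<bar>1 / real L * (\<Sum>t=l..l + L - 1. covered (\<pi> u) y t) - \<phi>\<bar>
                \<le> (\<Lambda> + 2 * \<eta>) / (\<eta> * real L)) \<and>
          (\<forall>D. unit_distribution D \<longrightarrow>
              \<bar>\<integral>(u, y). (\<Sum>t=1..T. measure lborel (chosen (\<pi> u) y t) - optimal_cost D \<phi>)
                  \<partial>(R \<Otimes>\<^sub>M (\<Pi>\<^sub>M t\<in>{1..T}. D))\<bar>
                \<le> 400 * ?\<Lambda>\<^sup>2 * real T powr (3 / 4) * ln (real T) ^ 1)"
        using policy_in_grid unfolding Let_def \<Lambda>_def \<eta>_def power_one_right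
        by (intro exI[of _ R] exI[of _ "\<lambda>_. policy"]) blast
    qed
  qed
qed

end
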